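(* Let $p\in\mathbb N_+$, $\delta\ge 0$, $L_p>0$, and let $f:\mathbb R^d\to\mathbb R$ be convex with a minimizer $x^*$ and $p$ times continuously differentiable with $\|\nabla^p f(x)-\nabla^p f(y)\|\le L_p\|x-y\|$ for all $x,y\in\mathbb R^d$. Let $H(x)\in\mathbb R^{d\times d}$ be a $\delta$-Hessian estimator, i.e. $H(x)=H(x)^\top$ and $\|H(x)-\nabla^2 f(x)\|\le\delta$ for all $x\in\mathbb{R}^d$. Run the AINE algorithm (see context) from $x_0\in\mathbb R^d$ for $T\ge 1$ iterations with a $p$th-order $\delta$-MS oracle, where the guesses are selected according to $$\lambda'_s=\Theta\Big(\delta+\big(D_0L_p^{\frac{2}{p-1}}/A_s^{\frac32}\big)^{\frac{2(p-1)}{3p+1}}\Big),\qquad D_0=\tfrac12\|x_0-x^*\|^2 .$$ Then $$A_T=\Omega\left(\min\left\{\frac{T^2}{\delta},\frac{T^{(3p+1)/2}}{D_0^{(p-1)/2}L_p}\right\}\right)\quad\text{and}\quad f(x_T)-f(x^* )\le\frac{D_0}{A_T}=O\left(\frac{\delta D_0}{T^2}+\frac{L_pD_0^{(p+1)/2}}{T^{(3p+1)/2}}\right).$$ The constants hidden in $\Omega$ and $O$ depend only on $p$, on the oracle constant $c$, and on the constants in the $\Theta$ defining $\lambda'_s$.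
   Context: Norms: Euclidean norm for vectors, operator norm for matrices and tensors. Write $\mathbb R_+=[0,\infty)$. $p$th-order $\delta$-MS oracle: a mapping $\mathbb O_p^\delta:\mathbb R^d\to\mathbb R^d\times\mathbb R_+$ such that, for each input $x$, the output $(y,\lambda)=\mathbb O_p^\delta(x)$ satisfies (1) the MS condition $\|\nabla f(y)+\lambda(y-x)\|\le\frac{\lambda}{2}\|y-x\|$; and (2) the $\delta$-inexact movement bound $\lambda\le c\,(\delta+L_p\|y-x\|^{p-1}/p!)$, for a constant $c>0$ (with $\|y-x\|^{0}=1$). AINE algorithm (inputs $x_0,T,\delta,L_p$). Initialize $v_0=z_0=x_0$, $A_0=0$, $(y_0,\lambda_0)=\mathbb O_p^\delta(z_0)$. For $t=0,\dots,T-1$: - Guess $\lambda'_t$: if $t=0$, $\lambda'_0=\lambda_0$; else if $t=1$ or $A_t>2A_s$ (where $s$ is the currently stored index), set $s:=t$, store $A_s=A_t$, and choose $\lambda'_t=\lambda'_s$ by the given formula (with $A_s$); otherwise $\lambda'_t=\lambda'_s$ for the stored $s$. - $a'_{t+1}=\big(1+\sqrt{1+4\lambda'_tA_t}\big)/(2\lambda'_t)$, $A'_{t+1}=A_t+a'_{t+1}$, $z_t=(A_tx_t+a'_{t+1}v_t)/A'_{t+1}$. - If $t>0$: $(y_t,\lambda_t)=\mathbb O_p^\delta(z_t)$. - $\beta_t=\min\{1,\lambda'_t/\lambda_t\}$, $a_{t+1}=\beta_ta'_{t+1}$, $A_{t+1}=A_t+a_{t+1}$. - $\hat x_{t+1}=\big((1-\beta_t)A_tx_t+\beta_tA'_{t+1}y_t\big)/A_{t+1}$.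 - If $p\in\{1,2\}$, $x_{t+1}=\hat x_{t+1}$; otherwise $x_{t+1}$ is a point of $\{x_0,\dots,x_t,\hat x_{t+1}\}$ with smallest value of $f$. - $v_{t+1}=v_t-a_{t+1}\nabla f(y_t)$. Output $x_T$. Conventions: $\lambda'_s=\Theta(X)$ means $c_1X\le\lambda'_s\le c_2X$ for fixed constants $0<c_1\le c_2$. For $p=1$ the expression $(D_0L_p^{2/(p-1)}/A_s^{3/2})^{2(p-1)/(3p+1)}$ is read as $D_0^{2(p-1)/(3p+1)}L_p^{4/(3p+1)}A_s^{-3(p-1)/(3p+1)}$, i.e. $L_1$. If $\lambda_t=0$ then $\lambda_t'/\lambda_t$ is $+\infty$; it is assumed that $\lambda_0>0$ so that the algorithm is well defined ($\lambda_0=0$ forces $\nabla f(y_0)=0$). Quotients $T^2/\delta$ etc. with zero denominator are read as $+\infty$. *)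

theory Defs
  imports "HOL-Analysis.Analysis"
begin

text \<open>
  The constants hidden in the asymptotic bounds may not depend on the dimension, so the dimension
  has to be quantified inside the formula. Points of the \<open>d\<close>-dimensional space are therefore the
  elements of the carrier of the library topology \<^const>\<open>Euclidean_space\<close>, i.e. functions
  \<open>nat \<Rightarrow> real\<close> that vanish at all indices \<open>\<ge> d\<close>.
\<close>

type_synonym rvec = "nat \<Rightarrow> real"

abbreviation Rd :: "nat \<Rightarrow> rvec set" where
  "Rd d \<equiv> topspace (Euclidean_space d)"

definition vnorm :: "nat \<Rightarrow> rvec \<Rightarrow> real" where
  "vnorm d u = L2_set u {..<d}"

definition convex_fun :: "nat \<Rightarrow> (rvec \<Rightarrow> real) \<Rightarrow> bool" where
  "convex_fun d f \<longleftrightarrow>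
     (\<forall>x\<in>Rd d. \<forall>y\<in>Rd d. \<forall>t. 0 \<le> t \<and> t \<le> 1 \<longrightarrow>
        f (\<lambda>i. (1 - t) * x i + t * y i) \<le> (1 - t) * f x + t * f y)"

definition is_minimizer :: "nat \<Rightarrow> (rvec \<Rightarrow> real) \<Rightarrow> rvec \<Rightarrow> bool" where
  "is_minimizer d f u \<longleftrightarrow> u \<in> Rd d \<and> (\<forall>x\<in>Rd d. f u \<le> f x)"


subsection \<open>Derivatives and operator norms\<close>

definition has_partial :: "nat \<Rightarrow> (rvec \<Rightarrow> real) \<Rightarrow> rvec \<Rightarrow> bool" where
  "has_partial i f x \<longleftrightarrow> (\<lambda>t. f (x(i := t))) differentiable (at (x i))"

definition partial :: "nat \<Rightarrow> (rvec \<Rightarrow> real) \<Rightarrow> rvec \<Rightarrow> real" where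
  "partial i f x = deriv (\<lambda>t. f (x(i := t))) (x i)"

fun iter_partial :: "nat list \<Rightarrow> (rvec \<Rightarrow> real) \<Rightarrow> rvec \<Rightarrow> real" where
  "iter_partial [] f = f"
| "iter_partial (i # is) f = partial i (iter_partial is f)"

definition Ck_fun :: "nat \<Rightarrow> nat \<Rightarrow> (rvec \<Rightarrow> real) \<Rightarrow> bool" where
  "Ck_fun d k f \<longleftrightarrow>
     (\<forall>is. set is \<subseteq> {..<d} \<and> length is < k \<longrightarrow>
        (\<forall>x\<in>Rd d. \<forall>i<d. has_partial i (iter_partial is f) x)) \<and>
     (\<forall>is. set is \<subseteq> {..<d} \<and> length is \<le> k \<longrightarrow>
        continuous_map (Euclidean_space d) euclideanreal (iter_partial is f))"

definition grad :: "nat \<Rightarrow> (rvec \<Rightarrow> real) \<Rightarrow> rvec \<Rightarrow> rvec" where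
  "grad d f x = (\<lambda>i. if i < d then partial i f x else 0)"

definition hessian :: "(rvec \<Rightarrow> real) \<Rightarrow> rvec \<Rightarrow> nat \<Rightarrow> nat \<Rightarrow> real" where
  "hessian f x i j = partial i (partial j f) x"

definition mat_opnorm :: "nat \<Rightarrow> (nat \<Rightarrow> nat \<Rightarrow> real) \<Rightarrow> real" where
  "mat_opnorm d M =
     Sup {vnorm d (\<lambda>i. \<Sum>j<d. M i j * u j) | u. u \<in> Rd d \<and> vnorm d u \<le> 1}"

text \<open>
  A tensor of order \<open>k\<close> is given by its entries, indexed by lists of length \<open>k\<close> over \<open>{..<d}\<close>.
  Its operator norm is that of the associated \<open>k\<close>-linear form.
\<close>

definition tensor_opnorm :: "nat \<Rightarrow> nat \<Rightarrow> (nat list \<Rightarrow> real) \<Rightarrow> real" where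
  "tensor_opnorm d k \<tau> =
     Sup {\<bar>\<Sum>is\<in>{is. set is \<subseteq> {..<d} \<and> length is = k}. \<tau> is * (\<Prod>j<k. u j (is ! j))\<bar> | u.
            \<forall>j<k. u j \<in> Rd d \<and> vnorm d (u j) \<le> 1}"

definition lipschitz_deriv :: "nat \<Rightarrow> nat \<Rightarrow> real \<Rightarrow> (rvec \<Rightarrow> real) \<Rightarrow> bool" where
  "lipschitz_deriv d p L f \<longleftrightarrow>
     (\<forall>x\<in>Rd d. \<forall>y\<in>Rd d.
        tensor_opnorm d p (\<lambda>is. iter_partial is f x - iter_partial is f y)
          \<le> L * vnorm d (\<lambda>i. x i - y i))"

text \<open>
  The existence of the Hessian is part of the definition: it is automatic for functions of class
  \<open>C\<^sup>2\<close>, but for \<open>C\<^sup>1\<close> functions the estimation bound would otherwise refer to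
  unspecified values of \<^const>\<open>deriv\<close>.
\<close>

definition hessian_estimator ::
    "nat \<Rightarrow> (rvec \<Rightarrow> real) \<Rightarrow> real \<Rightarrow> (rvec \<Rightarrow> nat \<Rightarrow> nat \<Rightarrow> real) \<Rightarrow> bool" where
  "hessian_estimator d f \<delta> H \<longleftrightarrow>
     (\<forall>x\<in>Rd d.
        (\<forall>i<d. \<forall>j<d. has_partial i (partial j f) x) \<and>
        (\<forall>i<d. \<forall>j<d. H x i j = H x j i) \<and>
        mat_opnorm d (\<lambda>i j. H x i j - hessian f x i j) \<le> \<delta>)"


subsection \<open>Oracle\<close>

definition ms_oracle ::
    "nat \<Rightarrow> nat \<Rightarrow> (rvec \<Rightarrow> real) \<Rightarrow> real \<Rightarrow> real \<Rightarrow> real \<Rightarrow> (rvec \<Rightarrow> rvec \<times> real) \<Rightarrow> bool" where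
  "ms_oracle d p f \<delta> L c Orc \<longleftrightarrow>
     (\<forall>x\<in>Rd d. \<forall>y l. Orc x = (y, l) \<longrightarrow>
        y \<in> Rd d \<and> 0 \<le> l \<and>
        vnorm d (\<lambda>i. grad d f y i + l * (y i - x i)) \<le> l / 2 * vnorm d (\<lambda>i. y i - x i) \<and>
        l \<le> c * (\<delta> + L * vnorm d (\<lambda>i. y i - x i) ^ (p - 1) / fact p))"


subsection \<open>The AINE algorithm\<close>

definition guess_size :: "nat \<Rightarrow> real \<Rightarrow> real \<Rightarrow> real \<Rightarrow> real \<Rightarrow> real" where
  "guess_size p \<delta> L D0 As =
     \<delta> + (if p = 1 then L
          else (D0 * L powr (2 / (real p - 1)) / As powr (3 / 2))
                 powr (2 * (real p - 1) / (3 * real p + 1)))"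

text \<open>
  The quantities of a run, as sequences. The entry \<open>stored t\<close> is the index \<open>s\<close> that is stored when
  iteration \<open>t\<close> uses its guess \<open>gl t\<close> (the \<open>\<lambda>'\<close> of iteration \<open>t\<close>); it is irrelevant for \<open>t = 0\<close>.
  The entries \<open>ga\<close> and \<open>gA\<close> are the tentative increments and sums \<open>a'\<close> and \<open>A'\<close>.
\<close>

record aine_trace =
  xx :: "nat \<Rightarrow> rvec"
  xhat :: "nat \<Rightarrow> rvec"
  vv :: "nat \<Rightarrow> rvec"
  zz :: "nat \<Rightarrow> rvec"
  yy :: "nat \<Rightarrow> rvec"
  lam :: "nat \<Rightarrow> real"
  gl :: "nat \<Rightarrow> real"
  ga :: "nat \<Rightarrow> real"
  gA :: "nat \<Rightarrow> real"
  aa :: "nat \<Rightarrow> real"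
  AA :: "nat \<Rightarrow> real"
  beta :: "nat \<Rightarrow> real"
  stored :: "nat \<Rightarrow> nat"

definition aine_init :: "(rvec \<Rightarrow> rvec \<times> real) \<Rightarrow> rvec \<Rightarrow> aine_trace \<Rightarrow> bool" where
  "aine_init Orc x0 r \<longleftrightarrow>
     xx r 0 = x0 \<and> vv r 0 = x0 \<and> zz r 0 = x0 \<and> AA r 0 = 0 \<and>
     (yy r 0, lam r 0) = Orc (zz r 0)"

definition aine_guess ::
    "nat \<Rightarrow> real \<Rightarrow> real \<Rightarrow> real \<Rightarrow> real \<Rightarrow> real \<Rightarrow> aine_trace \<Rightarrow> nat \<Rightarrow> bool" where
  "aine_guess p \<delta> L c1 c2 D0 r t \<longleftrightarrow>
     (if t = 0 then gl r t = lam r t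
      else if t = 1 \<or> AA r t > 2 * AA r (stored r (t - 1))
      then stored r t = t \<and>
           c1 * guess_size p \<delta> L D0 (AA r t) \<le> gl r t \<and>
           gl r t \<le> c2 * guess_size p \<delta> L D0 (AA r t)
      else stored r t = stored r (t - 1) \<and> gl r t = gl r (stored r t))"

text \<open>
  In the clause for \<open>beta\<close>, the quotient \<open>gl r t / lam r t\<close> is read as infinite if \<open>lam r t = 0\<close>.
\<close>

definition aine_step ::
    "nat \<Rightarrow> (rvec \<Rightarrow> real) \<Rightarrow> (rvec \<Rightarrow> rvec \<times> real) \<Rightarrow> nat \<Rightarrow> aine_trace \<Rightarrow> nat \<Rightarrow> bool" where
  "aine_step p f Orc d r t \<longleftrightarrow>
     ga r (t + 1) = (1 + sqrt (1 + 4 * gl r t * AA r t)) / (2 * gl r t) \<and>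
     gA r (t + 1) = AA r t + ga r (t + 1) \<and>
     zz r t = (\<lambda>i. (AA r t * xx r t i + ga r (t + 1) * vv r t i) / gA r (t + 1)) \<and>
     (t > 0 \<longrightarrow> (yy r t, lam r t) = Orc (zz r t)) \<and>
     beta r t = (if lam r t = 0 then 1 else min 1 (gl r t / lam r t)) \<and>
     aa r (t + 1) = beta r t * ga r (t + 1) \<and>
     AA r (t + 1) = AA r t + aa r (t + 1) \<and>
     xhat r (t + 1) =
       (\<lambda>i. ((1 - beta r t) * AA r t * xx r t i + beta r t * gA r (t + 1) * yy r t i)
              / AA r (t + 1)) \<and>
     (if p \<in> {1, 2} then xx r (t + 1) = xhat r (t + 1)
      else is_arg_min f (\<lambda>u. u \<in> insert (xhat r (t + 1)) (xx r ` {..t})) (xx r (t + 1))) \<and>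
     vv r (t + 1) = (\<lambda>i. vv r t i - aa r (t + 1) * grad d f (yy r t) i)"

definition aine_run ::
    "nat \<Rightarrow> nat \<Rightarrow> (rvec \<Rightarrow> real) \<Rightarrow> real \<Rightarrow> real \<Rightarrow> real \<Rightarrow> real \<Rightarrow> real \<Rightarrow>
     (rvec \<Rightarrow> rvec \<times> real) \<Rightarrow> rvec \<Rightarrow> nat \<Rightarrow> aine_trace \<Rightarrow> bool" where
  "aine_run d p f \<delta> L c1 c2 D0 Orc x0 T r \<longleftrightarrow>
     aine_init Orc x0 r \<and>
     (\<forall>t<T. aine_guess p \<delta> L c1 c2 D0 r t \<and> aine_step p f Orc d r t)"


subsection \<open>Rates\<close>

text \<open>
  Division in \<^typ>\<open>ereal\<close> by a zero denominator yields \<open>\<infinity>\<close> for the positive numerators used here.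
  The power of \<open>D0\<close> with exponent \<open>(p - 1) / 2\<close> is written as \<open>sqrt D0 ^ (p - 1)\<close>, because it
  has to be \<open>1\<close> for \<open>p = 1\<close> even if \<open>D0 = 0\<close>, whereas \<open>0 powr 0 = 0\<close>.
\<close>

definition lower_rate :: "nat \<Rightarrow> real \<Rightarrow> real \<Rightarrow> real \<Rightarrow> nat \<Rightarrow> ereal" where
  "lower_rate p \<delta> L D0 T =
     min (ereal (real T ^ 2) / ereal \<delta>)
         (ereal (real T powr ((3 * real p + 1) / 2)) / ereal (sqrt D0 ^ (p - 1) * L))"

definition upper_rate :: "nat \<Rightarrow> real \<Rightarrow> real \<Rightarrow> real \<Rightarrow> nat \<Rightarrow> real" where
  "upper_rate p \<delta> L D0 T =
     \<delta> * D0 / real T ^ 2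
     + L * D0 powr ((real p + 1) / 2) / real T powr ((3 * real p + 1) / 2)"

end

theory Submission
  imports Defs
begin

text \<open>
  The energy \<open>A\<^sub>t (f x\<^sub>t - f x\<^sup>*) + |v\<^sub>t - x\<^sup>*|\<^sup>2 / 2\<close> starts at \<open>D0\<close> and drops in every step by at
  least \<open>3/8 min \<lambda>\<^sub>t \<lambda>'\<^sub>t A' |y\<^sub>t - z\<^sub>t|\<^sup>2\<close>; this gives \<open>f x\<^sub>T - f x\<^sup>* \<le> D0 / A\<^sub>T\<close>.

  For the growth of \<open>A\<close>, put \<open>\<Phi> A = sqrt (\<delta> A) + (sqrt D0 ^ (p - 1) * L * A) powr (2 / (3 p + 1))\<close>. While the guess
  \<open>\<lambda>'\<close> stored at \<open>s\<close> is in use, \<open>A\<close> stays between \<open>A\<^sub>s\<close> and \<open>2 A\<^sub>s\<close>, and each step either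
  increases \<open>sqrt A\<close> by a multiple of \<open>1 / sqrt \<lambda>'\<close> or consumes a fixed portion of the energy.
  The size of the guess balances the two numbers of steps: both are at most a multiple of
  \<open>\<Phi> A\<^sub>s\<close>. Since \<open>A\<close> doubles between consecutive stored indices, \<open>\<Phi> A\<^sub>s\<close> grows geometrically, so
  the total number of steps is at most a multiple of \<open>\<Phi> A\<^sub>T\<close>.
\<close>

section \<open>Convex functions in coordinates\<close>

lemma in_Rd_iff: "x \<in> Rd d \<longleftrightarrow> (\<forall>i\<ge>d. x i = 0)"
  by (simp add: topspace_Euclidean_space)

lemma vnorm_nonneg: "0 \<le> vnorm d u"
  by (simp add: vnorm_def L2_set_nonneg)

lemma vnorm_power2: "(vnorm d u)\<^sup>2 = (\<Sum>i<d. (u i)\<^sup>2)"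
  by (simp add: vnorm_def L2_set_def sum_nonneg)

lemma convex_funD:
  assumes "convex_fun d f" "x \<in> Rd d" "y \<in> Rd d" "0 \<le> t" "t \<le> 1"
  shows "f (\<lambda>i. (1 - t) * x i + t * y i) \<le> (1 - t) * f x + t * f y"
  using assms unfolding convex_fun_def by blast

text \<open>Jensen's inequality with uniform weights: the new point receives weight
  \<open>1 / Suc n\<close> and the old average keeps the rest.\<close>

lemma convex_fun_average:
  assumes "convex_fun d f" "n \<ge> 1" "\<And>k. k < n \<Longrightarrow> w k \<in> Rd d"
  shows "f (\<lambda>i. (\<Sum>k<n. w k i) / real n) \<le> (\<Sum>k<n. f (w k)) / real n"
  using assms(2,3)
proof (induction n rule: nat_induct_at_least)
  case base
  then show ?case by simp
next
  case (Suc n)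
  define t where "t = 1 / real (Suc n)"
  define x where "x = (\<lambda>i. (\<Sum>k<n. w k i) / real n)"
  have n: "real n > 0" using Suc.hyps by simp
  have "t * real (Suc n) = 1" by (simp add: t_def del: of_nat_Suc)
  then have "1 - t = t * real n" by (simp add: algebra_simps)
  then have t: "0 \<le> t" "t \<le> 1" "(1 - t) / real n = t"
    using n by (auto simp: t_def)
  have "x \<in> Rd d" using Suc.prems by (auto simp: in_Rd_iff x_def)
  then have "f (\<lambda>i. (1 - t) * x i + t * w n i) \<le> (1 - t) * f x + t * f (w n)"
    using convex_funD[OF assms(1)] Suc.prems t by simp
  also have "(1 - t) * f x \<le> (1 - t) * ((\<Sum>k<n. f (w k)) / real n)"
    using Suc t unfolding x_def by (intro mult_left_mono) auto
  also have "(1 - t) * ((\<Sum>k<n. f (w k)) / real n) + t * f (w n) = (\<Sum>k<Suc n. f (w k)) / real (Suc n)"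
    using arg_cong[OF t(3), of "\<lambda>u. u * (\<Sum>k<n. f (w k))"] by (simp add: t_def add_divide_distrib)
  also have "(\<lambda>i. (1 - t) * x i + t * w n i) = (\<lambda>i. (\<Sum>k<Suc n. w k i) / real (Suc n))"
  proof
    fix i
    have "(1 - t) * x i = t * (\<Sum>k<n. w k i)"
      using arg_cong[OF t(3), of "\<lambda>u. u * (\<Sum>k<n. w k i)"] by (simp add: x_def)
    then show "(1 - t) * x i + t * w n i = (\<Sum>k<Suc n. w k i) / real (Suc n)"
      by (simp add: t_def add_divide_distrib)
  qed
  finally show ?case by simp
qed

text \<open>
  Convexity bounds \<open>f (x - t u)\<close> from below by \<open>(1 + t) f x - t f (x + u)\<close> and from above by the
  average of \<open>f\<close> at the points \<open>x - t d u\<^sub>i e\<^sub>i\<close>; so existence of the partial derivatives at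
  \<open>x\<close> suffices and differentiability need not be shown.
\<close>

lemma convex_gradient_inequality:
  assumes cvx: "convex_fun d f" and d: "d \<ge> 1" and x: "x \<in> Rd d" and y: "y \<in> Rd d"
    and part: "\<And>i. i < d \<Longrightarrow> has_partial i f x"
  shows "(\<Sum>i<d. grad d f x i * (y i - x i)) \<le> f y - f x"
proof -
  define \<phi> where "\<phi> = (\<lambda>i t. f (x(i := x i - t * (real d * (y i - x i)))))"
  \<comment> \<open>The upper minus the lower bound: \<open>\<Psi>\<close> is nonnegative for
    \<open>t > 0\<close> and zero at \<open>0\<close>, so its derivative at \<open>0\<close>, which
    is the gap in the claim, is nonnegative.\<close>
  define \<Psi> where "\<Psi> = (\<lambda>t. t * f y - (1 + t) * f x + (\<Sum>i<d. \<phi> i t) / real d)"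
  have dpos: "real d > 0" using d by simp
  have \<phi>_deriv: "(\<phi> i has_real_derivative - (real d * (y i - x i)) * grad d f x i) (at 0)"
    if "i < d" for i
  proof -
    have "((\<lambda>s. f (x(i := s))) has_real_derivative grad d f x i) (at (x i))"
      using part[OF that] that
      by (auto simp: has_partial_def grad_def partial_def DERIV_deriv_iff_real_differentiable)
    then have "((\<lambda>s. f (x(i := s))) has_real_derivative grad d f x i)
        (at (x i - 0 * (real d * (y i - x i))))" by simp
    then have "((\<lambda>t. f (x(i := x i - t * (real d * (y i - x i))))) has_real_derivative
        grad d f x i * (- (real d * (y i - x i)))) (at 0)"
      by (rule DERIV_chain2) (auto intro!: derivative_eq_intros)
    then show ?thesis by (simp add: \<phi>_def mult.commute)
  qed
  have \<Psi>_nonneg: "\<Psi> t \<ge> 0" if t: "t > 0" for t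
  proof -
    define w where "w = (\<lambda>k. x(k := x k - t * (real d * (y k - x k))))"
    define u where "u = (\<lambda>i. x i - t * (y i - x i))"
    have u: "u \<in> Rd d" using x y by (auto simp: in_Rd_iff u_def)
    have "w k \<in> Rd d" if "k < d" for k using x that by (auto simp: in_Rd_iff w_def)
    then have avg: "f (\<lambda>i. (\<Sum>k<d. w k i) / real d) \<le> (\<Sum>k<d. f (w k)) / real d"
      by (rule convex_fun_average[OF cvx d])
    \<comment> \<open>Each coordinate moves in just one of the \<open>d\<close> points, so the
      factor \<open>d\<close> in the displacement cancels the averaging.\<close>
    have "(\<lambda>i. (\<Sum>k<d. w k i) / real d) = u"
    proof
      fix i
      have "(\<Sum>k<d. w k i) = (\<Sum>k<d. x i - (if k = i then t * (real d * (y i - x i)) else 0))"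
        by (intro sum.cong) (auto simp: w_def)
      also have "\<dots> = real d * x i - (if i < d then t * (real d * (y i - x i)) else 0)"
        by (simp add: sum_subtractf)
      also have "\<dots> = real d * u i"
        using x y by (auto simp: u_def in_Rd_iff algebra_simps)
      finally show "(\<Sum>k<d. w k i) / real d = u i" using dpos by simp
    qed
    with avg have fu: "f u \<le> (\<Sum>k<d. \<phi> k t) / real d" by (simp add: w_def \<phi>_def)
    \<comment> \<open>The point \<open>x\<close> lies on the segment from \<open>u\<close> to
      \<open>y\<close>, with weight \<open>t / (1 + t)\<close> at \<open>y\<close>.\<close>
    have "f (\<lambda>i. (1 - t / (1 + t)) * u i + t / (1 + t) * y i)
        \<le> (1 - t / (1 + t)) * f u + t / (1 + t) * f y"
      using t by (intro convex_funD[OF cvx u y]) auto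
    moreover have "(1 - t / (1 + t)) * u i + t / (1 + t) * y i = x i" for i
    proof -
      have "(1 - t / (1 + t)) * u i + t / (1 + t) * y i = (u i + t * y i) / (1 + t)"
        using t by (simp add: divide_simps)
      also have "u i + t * y i = x i * (1 + t)" by (simp add: u_def algebra_simps)
      finally show ?thesis using t by simp
    qed
    ultimately have "(1 + t) * f x \<le> (1 + t) * ((1 - t / (1 + t)) * f u + t / (1 + t) * f y)"
      using t by (intro mult_left_mono) auto
    also have "\<dots> = ((1 + t) * (1 - t / (1 + t))) * f u + ((1 + t) * (t / (1 + t))) * f y"
      by (simp only: distrib_left mult.assoc)
    also have "(1 + t) * (1 - t / (1 + t)) = 1" using t by (simp add: divide_simps)
    also have "(1 + t) * (t / (1 + t)) = t" using t by simp
    finally have "(1 + t) * f x \<le> f u + t * f y" by simp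
    then show ?thesis using fu by (simp add: \<Psi>_def)
  qed
  have \<Psi>0: "\<Psi> 0 = 0" using dpos by (simp add: \<Psi>_def \<phi>_def)
  have "(\<Psi> has_real_derivative f y - f x +
      (\<Sum>i<d. - (real d * (y i - x i)) * grad d f x i) / real d) (at 0)"
    unfolding \<Psi>_def using d by (auto intro!: derivative_eq_intros DERIV_sum \<phi>_deriv)
  then have "((\<lambda>t. \<Psi> t / t) \<longlongrightarrow> f y - f x +
      (\<Sum>i<d. - (real d * (y i - x i)) * grad d f x i) / real d) (at 0)"
    by (simp add: DERIV_def \<Psi>0)
  then have lim: "((\<lambda>t. \<Psi> t / t) \<longlongrightarrow> f y - f x +
      (\<Sum>i<d. - (real d * (y i - x i)) * grad d f x i) / real d) (at_right 0)"
    by (rule filterlim_mono) (auto simp: at_le)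
  have "0 \<le> f y - f x + (\<Sum>i<d. - (real d * (y i - x i)) * grad d f x i) / real d"
    by (rule tendsto_lowerbound[OF lim])
      (auto simp: eventually_at_filter intro!: always_eventually divide_nonneg_pos \<Psi>_nonneg)
  also have "(\<Sum>i<d. - (real d * (y i - x i)) * grad d f x i) / real d
      = - (\<Sum>i<d. grad d f x i * (y i - x i))"
    using dpos by (simp add: sum_divide_distrib sum_negf mult.commute)
  finally show ?thesis by simp
qed

section \<open>Step length and guess size\<close>

text \<open>\<open>a\<close> is the positive root of a quadratic. The lower bound drops the
  \<open>1\<close> under the square root; it makes \<open>sqrt A\<close> grow by a multiple of
  \<open>1 / sqrt l\<close>.\<close>

lemma extrapolation_root:
  fixes l A a :: real
  assumes "l > 0" "A \<ge> 0" "a = (1 + sqrt (1 + 4 * l * A)) / (2 * l)"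
  shows "l * a\<^sup>2 = A + a" "a > 0" "1 / (2 * l) + sqrt A / sqrt l \<le> a"
proof -
  define s where "s = sqrt (1 + 4 * l * A)"
  have s: "s\<^sup>2 = 1 + 4 * l * A" "s \<ge> 0" using assms by (auto simp: s_def)
  have a: "a = (1 + s) / (2 * l)" using assms by (simp add: s_def)
  have "l * a\<^sup>2 = (1 + 2 * s + s\<^sup>2) / (4 * l)"
    using assms(1) unfolding a by (simp add: power2_eq_square field_simps)
  also have "\<dots> = A + a"
    using assms(1) unfolding a s(1) by (simp add: field_simps)
  finally show "l * a\<^sup>2 = A + a" .
  show "a > 0" using assms(1) s by (simp add: a add_pos_nonneg)
  have "2 * (sqrt l * sqrt A) = sqrt (4 * l * A)"
    by (simp add: real_sqrt_mult)
  also have "\<dots> \<le> s" by (simp add: s_def)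
  finally have le: "(1 + 2 * (sqrt l * sqrt A)) / (2 * l) \<le> a"
    using assms(1) unfolding a by (intro divide_right_mono) auto
  have "sqrt A / sqrt l = (2 * (sqrt l * sqrt A)) / (2 * l)"
    using assms(1) by (simp add: divide_simps)
  then show "1 / (2 * l) + sqrt A / sqrt l \<le> a"
    using le by (simp add: add_divide_distrib)
qed

lemma half_exponent: "4 / x / 2 = 2 / (x::real)"
  by simp

lemma sqrt_powr: "sqrt (x powr e) = x powr (e / 2)"
  by (simp add: powr_powr flip: powr_half_sqrt)

text \<open>Comparing exponents gives the case \<open>p > 1\<close>, and \<open>p = 1\<close> fits
  the same formula. Multiplied by \<open>A\<close>, the guess size becomes
  \<open>\<delta> * A\<close> plus the square of the second term of \<open>\<Phi> A\<close>.\<close>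

lemma guess_size_eq:
  assumes "p \<ge> 1" "L > 0" "D0 \<ge> 0" "A > 0"
  shows "guess_size p \<delta> L D0 A
    = \<delta> + (sqrt D0 ^ (p - 1) * L * A) powr (4 / (3 * real p + 1)) / A"
proof (cases "p = 1 \<or> D0 = 0")
  case True
  then show ?thesis using assms by (auto simp: guess_size_def)
next
  case False
  define m where "m = real p - 1"
  have m: "m > 0" "real p = m + 1" "real (p - 1) = m" using False assms by (auto simp: m_def)
  have D: "D0 > 0" using False assms by simp
  \<comment> \<open>Logarithms turn the claim into a linear identity in \<open>ln D0\<close>,
    \<open>ln L\<close> and \<open>ln A\<close>.\<close>
  have "ln (sqrt D0 ^ (p - 1)) = m * (ln D0 / 2)"
    using D m(3) by (simp add: ln_realpow ln_sqrt del: One_nat_def)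
  then have "(sqrt D0 ^ (p - 1) * L * A) powr (4 / (3 * real p + 1)) / A
      = exp (4 / (3 * m + 4) * (m * (ln D0 / 2) + ln L + ln A) - ln A)"
    using D assms m(2) by (simp add: powr_def ln_mult exp_diff add.commute del: One_nat_def)
  also have "\<dots> = exp (2 * m / (3 * m + 4) * (ln D0 + 2 / m * ln L - 3 / 2 * ln A))"
  proof -
    have "4 / (3 * m + 4) * (m * (ln D0 / 2) + ln L + ln A) - ln A
        = 2 * m / (3 * m + 4) * (ln D0 + 2 / m * ln L - 3 / 2 * ln A)"
      using m(1) by (simp add: divide_simps) (simp add: algebra_simps)
    then show ?thesis by simp
  qed
  also have "\<dots> = (D0 * L powr (2 / m) / A powr (3 / 2)) powr (2 * m / (3 * m + 4))"
    using D assms by (simp add: powr_def[of "_ / _"] ln_div ln_mult ln_powr)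
  finally show ?thesis using False m(2) by (simp add: guess_size_def add.commute)
qed

section \<open>Constants of the rate\<close>

text \<open>Largest ratio of \<open>lam r t\<close> to the guess that is not treated as
  overshooting. The bound \<open>2 * c / c1\<close> leaves at least half of an overshooting
  \<open>lam r t\<close> to the movement term; the \<open>1\<close> makes it exceed the
  guess.\<close>

definition slack :: "real \<Rightarrow> real \<Rightarrow> real" where
  "slack c c1 = max 1 (2 * c / c1)"

definition const_init :: "nat \<Rightarrow> real \<Rightarrow> real" where
  "const_init p c = sqrt (2 * c)
     + (2 * c * (sqrt (8 / 3) ^ (p - 1) / fact p)) powr (2 / (3 * real p + 1))"

text \<open>The first term counts steps that enlarge \<open>sqrt A\<close>, the second those paid by
  gains, which sum to at most \<open>8 / 3 * D0\<close>. For \<open>p = 1\<close> the exponent is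
  \<open>2 / 0 = 0\<close>.\<close>

definition const_epoch :: "nat \<Rightarrow> real \<Rightarrow> real \<Rightarrow> real \<Rightarrow> real" where
  "const_epoch p c c1 c2 = 2 * slack c c1 * sqrt c2
     + 8 / 3 * (1 / (c1 * (slack c c1 * fact p / (2 * c) * c1) powr (2 / (real p - 1))))"

text \<open>The quotient sums the geometric series of the lengths of all earlier epochs, traced back
  from the current one.\<close>

definition const_start :: "nat \<Rightarrow> real \<Rightarrow> real \<Rightarrow> real \<Rightarrow> real" where
  "const_start p c c1 c2 = const_init p c
     + (const_epoch p c c1 c2 + const_init p c) / (2 powr (2 / (3 * real p + 1)) - 1)"

section \<open>A single run: iterates and oracle outputs\<close>

locale aine =
  fixes p d T :: nat and c c1 c2 \<delta> L D0 :: real and f :: "rvec \<Rightarrow> real" and xstar x0 :: rvec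
    and Orc :: "rvec \<Rightarrow> rvec \<times> real" and r :: aine_trace
  assumes p: "p \<ge> 1" and c: "c > 0" and c1: "0 < c1" and c2: "c1 \<le> c2"
    and d: "d \<ge> 1" and \<delta>: "\<delta> \<ge> 0" and L: "L > 0"
    and convex: "convex_fun d f" and minimizer: "is_minimizer d f xstar" and Ck: "Ck_fun d p f"
    and ms_orc: "ms_oracle d p f \<delta> L c Orc" and x0: "x0 \<in> Rd d" and lam0: "snd (Orc x0) > 0"
    and D0: "D0 = 1 / 2 * (vnorm d (\<lambda>i. x0 i - xstar i))\<^sup>2"
    and T: "T \<ge> 1" and run: "aine_run d p f \<delta> L c1 c2 D0 Orc x0 T r"
begin

abbreviation "A \<equiv> AA r"

definition mov :: "nat \<Rightarrow> real" where
  "mov t = vnorm d (\<lambda>i. yy r t i - zz r t i)"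

definition energy :: "nat \<Rightarrow> real" where
  "energy t = A t * (f (xx r t) - f xstar) + 1 / 2 * (vnorm d (\<lambda>i. vv r t i - xstar i))\<^sup>2"

definition gain :: "nat \<Rightarrow> real" where
  "gain t = min (lam r t) (gl r t) * gA r (t + 1) * (mov t)\<^sup>2"

lemma initial:
  "xx r 0 = x0" "vv r 0 = x0" "zz r 0 = x0" "A 0 = 0" "(yy r 0, lam r 0) = Orc x0"
  using run unfolding aine_run_def aine_init_def by auto

lemma guess: "t < T \<Longrightarrow> aine_guess p \<delta> L c1 c2 D0 r t"
  and step: "t < T \<Longrightarrow> aine_step p f Orc d r t"
  using run unfolding aine_run_def by auto

lemma oracle_call: "t < T \<Longrightarrow> Orc (zz r t) = (yy r t, lam r t)"
  using step[of t] initial unfolding aine_step_def by (cases "t = 0") auto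

lemma next_iterate:
  assumes "t < T"
  shows "xx r (t + 1) = xhat r (t + 1) \<or> (\<exists>j\<le>t. xx r (t + 1) = xx r j)"
    and "f (xx r (t + 1)) \<le> f (xhat r (t + 1))"
proof -
  have "if p \<in> {1, 2} then xx r (t + 1) = xhat r (t + 1)
      else is_arg_min f (\<lambda>u. u \<in> insert (xhat r (t + 1)) (xx r ` {..t})) (xx r (t + 1))"
    using step[OF assms] unfolding aine_step_def by blast
  then show "xx r (t + 1) = xhat r (t + 1) \<or> (\<exists>j\<le>t. xx r (t + 1) = xx r j)"
    and "f (xx r (t + 1)) \<le> f (xhat r (t + 1))"
    by (auto simp: is_arg_min_def not_less split: if_splits)
qed

lemma zz_in_Rd:
  assumes "t < T" "xx r t \<in> Rd d" "vv r t \<in> Rd d"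
  shows "zz r t \<in> Rd d"
  using step[OF assms(1)] assms(2,3) unfolding aine_step_def by (auto simp: in_Rd_iff)

text \<open>The induction keeps all earlier \<open>xx r j\<close>, because for \<open>p > 2\<close>
  the next iterate may be any of them.\<close>

lemma iterates_in_Rd: "t \<le> T \<Longrightarrow> (\<forall>j\<le>t. xx r j \<in> Rd d) \<and> vv r t \<in> Rd d"
proof (induction t)
  case 0
  then show ?case using initial x0 by simp
next
  case (Suc t)
  then have t: "t < T" and IH: "\<forall>j\<le>t. xx r j \<in> Rd d" "vv r t \<in> Rd d" by auto
  have "yy r t \<in> Rd d"
    using ms_orc oracle_call[OF t] zz_in_Rd[OF t] IH unfolding ms_oracle_def by blast
  then have "xhat r (t + 1) \<in> Rd d" "vv r (t + 1) \<in> Rd d"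
    using step[OF t] IH unfolding aine_step_def by (auto simp: in_Rd_iff grad_def)
  then show ?case using next_iterate(1)[OF t] IH by (auto simp: le_Suc_eq)
qed

lemma oracle_output:
  assumes "t < T"
  shows "yy r t \<in> Rd d" and "0 \<le> lam r t"
    and "vnorm d (\<lambda>i. grad d f (yy r t) i + lam r t * (yy r t i - zz r t i)) \<le> lam r t / 2 * mov t"
    and "lam r t \<le> c * (\<delta> + L * mov t ^ (p - 1) / fact p)"
  using ms_orc oracle_call[OF assms] zz_in_Rd[OF assms] iterates_in_Rd[of t] assms
  unfolding ms_oracle_def mov_def by auto

lemma xstar_in_Rd: "xstar \<in> Rd d" and xstar_le: "x \<in> Rd d \<Longrightarrow> f xstar \<le> f x"
  using minimizer unfolding is_minimizer_def by auto

section \<open>Energy descent in one step\<close>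

lemma gradient_inequality:
  assumes "x \<in> Rd d" "y \<in> Rd d"
  shows "f x - f y \<le> (\<Sum>i<d. grad d f x i * (x i - y i))"
proof -
  have "has_partial i f x" if "i < d" for i
  proof -
    have "\<forall>x\<in>Rd d. \<forall>i<d. has_partial i (iter_partial [] f) x"
      using Ck p unfolding Ck_fun_def by (auto dest!: spec[of _ "[]"])
    then show ?thesis using that assms by simp
  qed
  from convex_gradient_inequality[OF convex d assms this]
  have "- (f y - f x) \<le> - (\<Sum>i<d. grad d f x i * (y i - x i))" by simp
  also have "\<dots> = (\<Sum>i<d. grad d f x i * (x i - y i))"
    by (subst sum_negf[symmetric]) (simp add: algebra_simps)
  finally show ?thesis by simp
qed

text \<open>Scaling by \<open>beta\<close> caps the oracle's \<open>lam r t\<close> at the guess for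
  which \<open>ga\<close> was computed: an overshooting oracle costs step length but not the
  descent.\<close>

lemma step_size:
  assumes "t < T" "gl r t > 0" "A t \<ge> 0"
  shows "gl r t * (ga r (t + 1))\<^sup>2 = gA r (t + 1)" and "ga r (t + 1) > 0"
    and "1 / (2 * gl r t) + sqrt (A t) / sqrt (gl r t) \<le> ga r (t + 1)"
    and "gA r (t + 1) = A t + ga r (t + 1)"
    and "A (t + 1) = A t + beta r t * ga r (t + 1)"
    and "0 < beta r t" "beta r t \<le> 1" "beta r t * lam r t = min (lam r t) (gl r t)"
    and "A t < A (t + 1)"
proof -
  note st = step[OF assms(1), unfolded aine_step_def]
  note l = oracle_output(2)[OF assms(1)]
  show "gl r t * (ga r (t + 1))\<^sup>2 = gA r (t + 1)" and ga: "ga r (t + 1) > 0"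
    and "1 / (2 * gl r t) + sqrt (A t) / sqrt (gl r t) \<le> ga r (t + 1)"
    using extrapolation_root[OF assms(2,3), of "ga r (t + 1)"] st by auto
  show "gA r (t + 1) = A t + ga r (t + 1)"
    and A: "A (t + 1) = A t + beta r t * ga r (t + 1)" using st by auto
  show b: "0 < beta r t" "beta r t \<le> 1"
    using st l assms(2) by auto
  show "beta r t * lam r t = min (lam r t) (gl r t)"
    using st l assms(2) by (auto simp: min_def field_simps)
  show "A t < A (t + 1)" using A b ga by simp
qed

text \<open>The gradient inequality at \<open>y\<close> is used against \<open>x\<close> with weight
  \<open>A t\<close> and against \<open>xstar\<close> with weight \<open>a\<close>. The term along
  \<open>v - xstar\<close> cancels in the expansion of the new distance; the squared oracle
  condition absorbs the rest and leaves the gain.\<close>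

lemma energy_descent:
  assumes t: "t < T" and gl: "gl r t > 0" and A: "A t \<ge> 0"
  shows "energy (t + 1) + 3 / 8 * gain t \<le> energy t"
proof -
  note st = step[OF t, unfolded aine_step_def]
  note ss = step_size[OF assms]
  note out = oracle_output[OF t]
  define g where "g = grad d f (yy r t)"
  define l where "l = lam r t"
  define b where "b = beta r t"
  define a where "a = ga r (t + 1)"
  define A' where "A' = gA r (t + 1)"
  define x where "x = xx r t"
  define y where "y = yy r t"
  define z where "z = zz r t"
  define v where "v = vv r t"
  define G where "G = (\<Sum>i<d. (g i)\<^sup>2)"
  define P where "P = (\<Sum>i<d. g i * (y i - z i))"
  define Q where "Q = (\<Sum>i<d. g i * (v i - xstar i))"
  define Fy where "Fy = f y - f xstar"
  define Fx where "Fx = f x - f xstar"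
  have x: "x \<in> Rd d" and v: "v \<in> Rd d" and y: "y \<in> Rd d"
    using iterates_in_Rd[of t] t out(1) by (auto simp: x_def v_def y_def)
  have l: "l \<ge> 0" using out(2) by (simp add: l_def)
  have b: "0 < b" "b \<le> 1" using ss by (auto simp: b_def)
  have a: "a > 0" and A': "A' = A t + a" "A' > 0" using ss A by (auto simp: a_def A'_def)
  have A1: "A (t + 1) = (1 - b) * A t + b * A'" "A (t + 1) > 0"
    using ss(1-8) le_less_trans[OF A ss(9)] by (auto simp: b_def a_def A'_def algebra_simps)
  have sum_grad: "A t * (Fy - Fx) + a * Fy \<le> A' * P + a * Q"
  proof -
    have "Fy - Fx \<le> (\<Sum>i<d. g i * (y i - x i))"
      using gradient_inequality[OF y x] by (simp add: Fy_def Fx_def g_def y_def)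
    then have "A t * (Fy - Fx) \<le> A t * (\<Sum>i<d. g i * (y i - x i))"
      using A by (intro mult_left_mono) auto
    moreover have "Fy \<le> (\<Sum>i<d. g i * (y i - xstar i))"
      using gradient_inequality[OF y xstar_in_Rd] by (simp add: Fy_def g_def y_def)
    then have "a * Fy \<le> a * (\<Sum>i<d. g i * (y i - xstar i))"
      using a by (intro mult_left_mono) auto
    \<comment> \<open>The choice of \<open>z\<close> gives \<open>A' * z = A t * x + a * v\<close>,
      so the combination of \<open>y - x\<close> and \<open>y - xstar\<close> equals
      \<open>A' * (y - z) + a * (v - xstar)\<close>.\<close>
    moreover have "A t * (\<Sum>i<d. g i * (y i - x i)) + a * (\<Sum>i<d. g i * (y i - xstar i)) = A' * P + a * Q"
    proof -
      have "A t * (g i * (y i - x i)) + a * (g i * (y i - xstar i))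
          = A' * (g i * (y i - z i)) + a * (g i * (v i - xstar i))" for i
      proof -
        have "A' * z i = A t * x i + a * v i"
          using st A'(2) by (simp add: z_def x_def v_def a_def A'_def)
        then have "A' * (g i * z i) = A t * (g i * x i) + a * (g i * v i)"
          by (metis (no_types, opaque_lifting) distrib_left mult.left_commute)
        then show ?thesis by (simp add: A'(1) algebra_simps)
      qed
      then show ?thesis
        by (simp add: P_def Q_def sum_distrib_left flip: sum.distrib)
    qed
    ultimately show ?thesis by linarith
  qed
  have "A (t + 1) * (f (xx r (t + 1)) - f xstar) \<le> (1 - b) * A t * Fx + b * A' * Fy"
  proof -
    define \<theta> where "\<theta> = b * A' / A (t + 1)"
    have "b * A' \<le> A (t + 1)" using A1(1) b A by simp
    then have \<theta>: "1 - \<theta> = (1 - b) * A t / A (t + 1)" "\<theta> \<ge> 0" "\<theta> \<le> 1"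
      using A1 b A A' by (auto simp: \<theta>_def divide_simps)
    have "xhat r (t + 1) = (\<lambda>i. (1 - \<theta>) * x i + \<theta> * y i)"
    proof -
      have "xhat r (t + 1) = (\<lambda>i. ((1 - b) * A t * x i + b * A' * y i) / A (t + 1))"
        using st unfolding b_def A'_def x_def y_def by blast
      then show ?thesis by (simp add: \<theta>(1)) (simp add: \<theta>_def add_divide_distrib)
    qed
    then have "f (xhat r (t + 1)) \<le> (1 - \<theta>) * f x + \<theta> * f y"
      using convex_funD[OF convex x y \<theta>(2,3)] by simp
    with next_iterate(2)[OF t]
    have "A (t + 1) * f (xx r (t + 1)) \<le> A (t + 1) * ((1 - \<theta>) * f x + \<theta> * f y)"
      using A1(2) by (intro mult_left_mono) auto
    also have "\<dots> = (A (t + 1) * (1 - \<theta>)) * f x + (A (t + 1) * \<theta>) * f y"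
      by (simp add: algebra_simps)
    also have "A (t + 1) * (1 - \<theta>) = (1 - b) * A t" using A1(2) by (simp add: \<theta>(1))
    also have "A (t + 1) * \<theta> = b * A'" using A1(2) by (simp add: \<theta>_def)
    finally have "A (t + 1) * f (xx r (t + 1)) \<le> (1 - b) * A t * f x + b * A' * f y" .
    moreover have "A (t + 1) * f xstar = (1 - b) * A t * f xstar + b * A' * f xstar"
      unfolding A1(1) by (simp add: algebra_simps)
    ultimately show ?thesis by (simp add: Fx_def Fy_def algebra_simps)
  qed
  also have "\<dots> = A t * Fx + b * (A t * (Fy - Fx) + a * Fy)"
    by (simp add: A'(1) algebra_simps)
  also have "\<dots> \<le> A t * Fx + b * (A' * P + a * Q)"
    using sum_grad b by simp
  finally have value_le: "A (t + 1) * (f (xx r (t + 1)) - f xstar) \<le> A t * Fx + b * (A' * P + a * Q)" .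
  have "(vnorm d (\<lambda>i. vv r (t + 1) i - xstar i))\<^sup>2 = (\<Sum>i<d. (v i - xstar i - b * a * g i)\<^sup>2)"
    using st by (simp add: vnorm_power2 v_def b_def a_def g_def algebra_simps)
  also have "\<dots> = (\<Sum>i<d. (v i - xstar i)\<^sup>2 - 2 * (b * a) * (g i * (v i - xstar i)) + (b * a)\<^sup>2 * (g i)\<^sup>2)"
    by (intro sum.cong refl) (simp add: power2_eq_square algebra_simps)
  also have "\<dots> = (vnorm d (\<lambda>i. v i - xstar i))\<^sup>2 - 2 * (b * a) * Q + (b * a)\<^sup>2 * G"
    by (simp only: vnorm_power2 sum.distrib sum_subtractf sum_distrib_left Q_def G_def)
  finally have dist: "(vnorm d (\<lambda>i. vv r (t + 1) i - xstar i))\<^sup>2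
      = (vnorm d (\<lambda>i. v i - xstar i))\<^sup>2 - 2 * (b * a) * Q + (b * a)\<^sup>2 * G" .
  \<comment> \<open>The squared right side takes \<open>1 / 4\<close> off the coefficient of
    \<open>l\<^sup>2\<close>; half of the remaining \<open>3 / 4\<close> becomes the constant
    \<open>3 / 8\<close>.\<close>
  have ms: "G + 2 * l * P + 3 / 4 * l\<^sup>2 * (mov t)\<^sup>2 \<le> 0"
  proof -
    have "(vnorm d (\<lambda>i. g i + l * (y i - z i)))\<^sup>2 \<le> (l / 2 * mov t)\<^sup>2"
      using out(3) by (intro power_mono) (auto simp: g_def l_def y_def z_def vnorm_nonneg)
    moreover have "(vnorm d (\<lambda>i. g i + l * (y i - z i)))\<^sup>2
        = (\<Sum>i<d. (g i)\<^sup>2 + 2 * l * (g i * (y i - z i)) + l\<^sup>2 * (y i - z i)\<^sup>2)"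
      unfolding vnorm_power2
      by (intro sum.cong refl) (simp add: power2_eq_square algebra_simps)
    moreover have "\<dots> = G + 2 * l * P + l\<^sup>2 * (mov t)\<^sup>2"
      by (simp add: G_def P_def mov_def vnorm_power2 sum.distrib sum_distrib_left y_def z_def)
    ultimately show ?thesis by (simp add: power_mult_distrib power_divide)
  qed
  have key: "b * A' * P + 1 / 2 * (b * a)\<^sup>2 * G + 3 / 8 * gain t \<le> 0"
  proof (cases "l = 0")
    case True
    \<comment> \<open>A zero multiplier forces a zero gradient, and the gain is zero too.\<close>
    then have "G \<le> 0" using ms by simp
    moreover have "G \<ge> 0" by (simp add: G_def sum_nonneg)
    ultimately have "(\<Sum>i<d. (g i)\<^sup>2) = 0" by (simp add: G_def)
    then have "\<forall>i<d. g i = 0" by (subst (asm) sum_nonneg_eq_0_iff) auto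
    then have "P = 0" "G = 0" by (simp_all add: P_def G_def)
    then show ?thesis using True gl by (simp add: gain_def l_def)
  next
    case False
    then have lpos: "l > 0" using l by simp
    \<comment> \<open>The identity \<open>gl r t * a\<^sup>2 = A'\<close> pays for the quadratic
      gradient term; multiplying the goal by \<open>2 * l\<close> then reduces it to
      \<open>ms\<close>.\<close>
    have "b * l \<le> gl r t" using ss(8) by (simp add: b_def l_def)
    then have "b * l * a\<^sup>2 \<le> A'"
      using ss(1) by (metis a_def A'_def mult_right_mono zero_le_power2)
    then have "b * G * (b * l * a\<^sup>2) \<le> b * G * A'"
      using b by (intro mult_left_mono) (auto simp: G_def sum_nonneg)
    moreover have "b * A' * (G + 2 * l * P + 3 / 4 * l\<^sup>2 * (mov t)\<^sup>2) \<le> 0"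
      using ms b A'(2) by (intro mult_nonneg_nonpos) auto
    moreover have "gain t = b * l * A' * (mov t)\<^sup>2"
      using ss(8) by (simp add: gain_def b_def l_def A'_def)
    ultimately have "2 * l * (b * A' * P + 1 / 2 * (b * a)\<^sup>2 * G + 3 / 8 * gain t) \<le> 0"
      by (simp add: power2_eq_square algebra_simps)
    then show ?thesis using lpos by (simp add: mult_le_0_iff)
  qed
  have "energy (t + 1) \<le> A t * Fx + b * (A' * P + a * Q)
      + 1 / 2 * ((vnorm d (\<lambda>i. v i - xstar i))\<^sup>2 - 2 * (b * a) * Q + (b * a)\<^sup>2 * G)"
    using value_le unfolding energy_def dist by simp
  also have "\<dots> = energy t + (b * A' * P + 1 / 2 * (b * a)\<^sup>2 * G)"
    by (simp add: energy_def Fx_def x_def v_def algebra_simps)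
  finally show ?thesis using key by linarith
qed

section \<open>Step counts measured by \<Phi>\<close>

definition \<Phi> :: "real \<Rightarrow> real" where
  "\<Phi> a = sqrt (\<delta> * a) + (sqrt D0 ^ (p - 1) * L * a) powr (2 / (3 * real p + 1))"

text \<open>Reciprocal of the gain guaranteed by a step with \<open>lam r t\<close> above
  \<open>slack\<close> times the guess, obtained by solving the movement bound for the movement. It
  is \<open>0\<close> for \<open>p = 1\<close>, where no such step exists.\<close>

definition weight :: "real \<Rightarrow> real \<Rightarrow> real" where
  "weight l a = (if p = 1 then 0
     else 1 / (l * a * (slack c c1 * fact p / (2 * c) * l / L) powr (2 / (real p - 1))))"

lemma D0_nonneg: "D0 \<ge> 0"
  by (simp add: D0)

lemma mov_nonneg: "mov t \<ge> 0"
  by (simp add: mov_def vnorm_nonneg)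

lemma slack: "slack c c1 \<ge> 1" "2 * c \<le> slack c c1 * c1"
  using c c1 by (auto simp: slack_def max_def field_simps)

lemma \<Phi>_nonneg: "a \<ge> 0 \<Longrightarrow> \<Phi> a \<ge> 0"
  using \<delta> by (simp add: \<Phi>_def)

lemma \<Phi>_mono: "0 \<le> a \<Longrightarrow> a \<le> b \<Longrightarrow> \<Phi> a \<le> \<Phi> b"
  unfolding \<Phi>_def using \<delta> L D0_nonneg
  by (intro add_mono powr_mono2 mult_left_mono real_sqrt_le_mono) auto

text \<open>Doubling multiplies the two terms by \<open>2 powr (1 / 2)\<close> and
  \<open>2 powr (2 / (3 * p + 1))\<close>; the second factor is no larger since
  \<open>p \<ge> 1\<close>.\<close>

lemma \<Phi>_double:
  assumes "0 \<le> a" "2 * a \<le> b"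
  shows "2 powr (2 / (3 * real p + 1)) * \<Phi> a \<le> \<Phi> b"
proof -
  have "2 powr (2 / (3 * real p + 1)) \<le> (2::real) powr (1 / 2)"
    using p by (intro powr_mono) (auto simp: field_simps)
  then have "2 powr (2 / (3 * real p + 1)) * sqrt (\<delta> * a) \<le> sqrt 2 * sqrt (\<delta> * a)"
    using \<delta> assms by (intro mult_right_mono) (auto simp: powr_half_sqrt)
  also have "\<dots> = sqrt (\<delta> * (2 * a))" by (simp flip: real_sqrt_mult)
  finally have "2 powr (2 / (3 * real p + 1)) * \<Phi> a \<le> \<Phi> (2 * a)"
    using L D0_nonneg assms(1)
    by (simp add: \<Phi>_def distrib_left powr_mult mult.left_commute)
  also have "\<dots> \<le> \<Phi> b" using assms by (intro \<Phi>_mono) auto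
  finally show ?thesis .
qed

text \<open>The left side is the number of increments \<open>1 / sqrt l\<close> that double
  \<open>sqrt a\<close>; the guess is small enough to keep it of order
  \<open>\<Phi> a\<close>.\<close>

lemma guess_size_\<Phi>:
  assumes "a > 0" "l \<ge> 0" "l \<le> c2 * guess_size p \<delta> L D0 a"
  shows "sqrt l * sqrt a \<le> sqrt c2 * \<Phi> a"
proof -
  define Y where "Y = sqrt D0 ^ (p - 1) * L * a"
  have Y: "Y \<ge> 0" using D0_nonneg L assms by (simp add: Y_def)
  have "l * a \<le> c2 * guess_size p \<delta> L D0 a * a" using assms by (intro mult_right_mono) auto
  also have "\<dots> = c2 * (\<delta> * a + Y powr (4 / (3 * real p + 1)))"
    using assms by (simp add: guess_size_eq[OF p L D0_nonneg] Y_def algebra_simps)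
  finally have "sqrt (l * a) \<le> sqrt (c2 * (\<delta> * a + Y powr (4 / (3 * real p + 1))))"
    by (rule real_sqrt_le_mono)
  also have "\<dots> = sqrt c2 * sqrt (\<delta> * a + Y powr (4 / (3 * real p + 1)))"
    by (simp add: real_sqrt_mult)
  also have "\<dots> \<le> sqrt c2 * (sqrt (\<delta> * a) + sqrt (Y powr (4 / (3 * real p + 1))))"
    using c1 c2 \<delta> assms by (intro mult_left_mono sqrt_add_le_add_sqrt) auto
  also have "sqrt (Y powr (4 / (3 * real p + 1))) = Y powr (2 / (3 * real p + 1))"
    unfolding sqrt_powr half_exponent ..
  finally show ?thesis by (simp add: \<Phi>_def Y_def real_sqrt_mult)
qed

text \<open>Bounds the number of steps that a total gain of order \<open>D0\<close> can pay for.
  Here a large guess helps, so its lower bound enters.\<close>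

lemma weight_\<Phi>:
  assumes a: "a > 0" and l: "l > 0" "c1 * guess_size p \<delta> L D0 a \<le> l"
  shows "D0 * weight l a \<le> 1 / (c1 * (slack c c1 * fact p / (2 * c) * c1) powr (2 / (real p - 1))) * \<Phi> a"
proof (cases "p = 1 \<or> D0 = 0")
  case True
  then have "D0 * weight l a = 0" by (auto simp: weight_def)
  then show ?thesis
    by (rule order_trans[OF eq_refl]) (use \<Phi>_nonneg[of a] a c1 in simp)
next
  case False
  define m where "m = real p - 1"
  define k where "k = slack c c1 * fact p / (2 * c)"
  define Y where "Y = sqrt D0 ^ (p - 1) * L * a"
  define q where "q = 4 / (3 * real p + 1)"
  define G where "G = Y powr q / a"
  have m: "m > 0" "real p = m + 1" "real (p - 1) = m" using False p by (auto simp: m_def)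
  have D: "D0 > 0" using False D0_nonneg by simp
  have k: "k > 0" using slack(1) c by (simp add: k_def)
  have Y: "Y > 0" using D L a by (simp add: Y_def)
  have G: "G > 0" using Y a by (simp add: G_def)
  have "c1 * G \<le> c1 * guess_size p \<delta> L D0 a"
    using c1 \<delta>
    by (intro mult_left_mono) (simp_all add: guess_size_eq[OF p L D0_nonneg a] G_def Y_def q_def)
  then have lG: "c1 * G \<le> l" using l(2) by simp
  have "ln (sqrt D0 ^ (p - 1)) = m * (ln D0 / 2)"
    using D m(3) by (simp add: ln_realpow ln_sqrt del: One_nat_def)
  then have lnY: "ln Y = m * (ln D0 / 2) + ln L + ln a"
    using D L a by (simp add: Y_def ln_mult)
  \<comment> \<open>This expresses \<open>D0\<close> through \<open>Y\<close> and \<open>G\<close>: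
    since \<open>3 * q / 2 + 2 / m * q = 2 / m\<close>, both \<open>L\<close> and \<open>a\<close>
    cancel.\<close>
  have "Y powr (3 * q / 2) * (G / L) powr (2 / m)
      = exp (3 * q / 2 * ln Y + 2 / m * (q * ln Y - ln a - ln L))"
    using Y a L G by (simp add: powr_def G_def ln_div ln_mult exp_add)
  also have "3 * q / 2 * ln Y + 2 / m * (q * ln Y - ln a - ln L)
      = (3 * q / 2 + 2 / m * q) * ln Y - 2 / m * (ln a + ln L)"
    by (simp add: algebra_simps)
  also have "3 * q / 2 + 2 / m * q = 2 / m"
    using m(1) by (simp add: q_def m(2) divide_simps) (simp add: algebra_simps)
  also have "2 / m * ln Y - 2 / m * (ln a + ln L) = ln D0"
    using m(1) by (simp add: lnY field_simps)
  finally have D0_eq: "D0 = Y powr (3 * q / 2) * (G / L) powr (2 / m)" using D by simp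
  define e where "e = c1 * (k * c1) powr (2 / m)"
  have e: "e > 0" using c1 k by (simp add: e_def)
  have "e * (Y powr q * (G / L) powr (2 / m)) = (c1 * G) * a * (k * (c1 * G) / L) powr (2 / m)"
  proof -
    have "k * (c1 * G) / L = (k * c1) * (G / L)" by simp
    then have "(k * (c1 * G) / L) powr (2 / m) = (k * c1) powr (2 / m) * (G / L) powr (2 / m)"
      using k c1 G L by (simp only: powr_mult)
    then show ?thesis using a by (simp add: e_def G_def)
  qed
  \<comment> \<open>The expression increases with the guess, so \<open>c1 * G\<close> can be
    replaced by \<open>l\<close>.\<close>
  also have "\<dots> \<le> l * a * (k * l / L) powr (2 / m)"
    using lG c1 G k L a m l by (intro mult_mono powr_mono2 divide_right_mono mult_left_mono) auto
  finally have low: "e * (Y powr q * (G / L) powr (2 / m)) \<le> l * a * (k * l / L) powr (2 / m)" .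
  have pos: "0 < e * (Y powr q * (G / L) powr (2 / m))"
    using e Y G L by simp
  have "D0 * weight l a = D0 / (l * a * (k * l / L) powr (2 / m))"
    using False by (simp add: weight_def k_def m_def)
  also have "\<dots> \<le> D0 / (e * (Y powr q * (G / L) powr (2 / m)))"
    using D by (intro divide_left_mono low mult_pos_pos[OF less_le_trans[OF pos low] pos]) simp
  also have "\<dots> = Y powr (3 * q / 2) / (e * Y powr q)"
    using Y G L by (subst D0_eq) simp
  also have "\<dots> = 1 / e * Y powr (3 * q / 2 - q)"
    by (simp only: powr_diff) simp
  also have "3 * q / 2 - q = q / 2" by simp
  also have "q / 2 = 2 / (3 * real p + 1)"
    unfolding q_def by (rule half_exponent)
  also have "1 / e * Y powr (2 / (3 * real p + 1)) \<le> 1 / e * \<Phi> a"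
    using e \<delta> a by (intro mult_left_mono) (auto simp: \<Phi>_def Y_def)
  finally show ?thesis by (simp add: e_def k_def m_def)
qed

lemma guess_size_ge:
  assumes "a > 0"
  shows "\<delta> \<le> guess_size p \<delta> L D0 a" "p = 1 \<Longrightarrow> guess_size p \<delta> L D0 a = \<delta> + L"
  using guess_size_eq[OF p L D0_nonneg assms] assms by (auto simp: guess_size_def)

lemma gain_nonneg: "t < T \<Longrightarrow> gl r t > 0 \<Longrightarrow> A t \<ge> 0 \<Longrightarrow> gain t \<ge> 0"
  using step_size[of t] oracle_output(2)[of t] by (simp add: gain_def)

text \<open>
  If \<open>\<lambda>\<^sub>t\<close> is at most \<open>slack\<close> times the guess, then \<open>sqrt A\<close> grows by a fixed amount. Otherwise
  the \<open>\<delta>\<close>-part of the movement bound cannot account for \<open>\<lambda>\<^sub>t\<close>, so the oracle moved far and the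
  energy drops; this is impossible for \<open>p = 1\<close>.
\<close>

lemma step_progress:
  assumes t: "t < T" and gl: "gl r t > 0" and a: "0 < a" "a \<le> A t"
    and guess_le: "c1 * guess_size p \<delta> L D0 a \<le> gl r t"
  shows "1 \<le> 2 * slack c c1 * sqrt (gl r t) * (sqrt (A (t + 1)) - sqrt (A t))
           + gain t * weight (gl r t) a"
proof -
  define K where "K = slack c c1"
  define l where "l = gl r t"
  define N where "N = mov t"
  have K: "K \<ge> 1" "2 * c \<le> K * c1" using slack by (auto simp: K_def)
  have l: "l > 0" using gl by (simp add: l_def)
  have At: "A t \<ge> 0" using a by simp
  have N: "N \<ge> 0" by (simp add: N_def mov_nonneg)
  note ss = step_size[OF t gl At]
  have g0: "gain t \<ge> 0" using gain_nonneg[OF t gl At] .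
  show ?thesis
  proof (cases "lam r t \<le> K * l")
    case True
    have "1 / K \<le> beta r t"
    proof (cases "lam r t = 0")
      case False
      then have "1 / K \<le> l / lam r t"
        using True K oracle_output(2)[OF t] by (simp add: divide_simps mult.commute)
      then show ?thesis using step[OF t] False K by (simp add: aine_step_def l_def)
    qed (use step[OF t] K in \<open>simp add: aine_step_def\<close>)
    then have "1 / K * (1 / (2 * l) + sqrt (A t) / sqrt l) \<le> beta r t * ga r (t + 1)"
      using ss K l At by (intro mult_mono) (auto simp: l_def)
    then have inc: "A t + sqrt (A t) / (K * sqrt l) + 1 / (2 * K * l) \<le> A (t + 1)"
      using ss by (simp add: distrib_left mult_ac)
    \<comment> \<open>Completing the square turns the increment of \<open>A\<close> into one of
      \<open>sqrt A\<close>; the last term fits because \<open>K \<ge> 1\<close>.\<close>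
    have "(sqrt (A t) + 1 / (2 * K * sqrt l))\<^sup>2 = A t + sqrt (A t) / (K * sqrt l) + 1 / (4 * K\<^sup>2 * l)"
      using K l At by (simp add: power2_sum power_divide power_mult_distrib)
    also have "1 / (4 * K\<^sup>2 * l) \<le> 1 / (2 * K * l)"
      using K l by (intro divide_left_mono) (auto simp: power2_eq_square intro!: mult_right_mono)
    finally have "(sqrt (A t) + 1 / (2 * K * sqrt l))\<^sup>2 \<le> A (t + 1)" using inc by simp
    then have "sqrt (A t) + 1 / (2 * K * sqrt l) \<le> sqrt (A (t + 1))"
      by (rule real_le_rsqrt)
    then have "2 * K * sqrt l * (1 / (2 * K * sqrt l)) \<le> 2 * K * sqrt l * (sqrt (A (t + 1)) - sqrt (A t))"
      using K l by (intro mult_left_mono) auto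
    moreover have "2 * K * sqrt l * (1 / (2 * K * sqrt l)) = 1" using K l by simp
    moreover have "weight l a \<ge> 0" using l a by (simp add: weight_def)
    then have "0 \<le> gain t * weight l a" using g0 by simp
    ultimately show ?thesis unfolding K_def l_def by linarith
  next
    case False
    have "2 * (c * guess_size p \<delta> L D0 a) \<le> K * (c1 * guess_size p \<delta> L D0 a)"
      using mult_right_mono[OF K(2), of "guess_size p \<delta> L D0 a"] guess_size_ge[OF a(1)] \<delta> by simp
    also have "\<dots> \<le> K * l" using guess_le K by (simp add: l_def)
    finally have guess_lt: "2 * (c * guess_size p \<delta> L D0 a) \<le> K * l" .
    have lam: "K * l < c * \<delta> + c * (L * N ^ (p - 1) / fact p)"
      using False oracle_output(4)[OF t] by (simp add: N_def algebra_simps)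
    \<comment> \<open>For \<open>p = 1\<close> the movement has power \<open>0\<close>, so
      \<open>lam r t\<close> is at most \<open>c\<close> times the guess size, hence at most half of
      \<open>K * l\<close>.\<close>
    have p1: "p \<noteq> 1"
    proof
      assume "p = 1"
      then have "K * l < c * (\<delta> + L)" using lam by (simp add: algebra_simps)
      moreover have "2 * (c * (\<delta> + L)) \<le> K * l"
        using guess_lt guess_size_ge(2)[OF a(1) \<open>p = 1\<close>] by simp
      moreover have "0 < K * l" using K l by simp
      ultimately show False by linarith
    qed
    define m where "m = real p - 1"
    have m: "m > 0" "real (p - 1) = m" using p1 p by (auto simp: m_def)
    define u where "u = K * fact p / (2 * c) * l / L"
    have u: "u > 0" using K c l L by (simp add: u_def)
    have "c * \<delta> \<le> c * guess_size p \<delta> L D0 a" using guess_size_ge(1)[OF a(1)] c by simp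
    then have "K * l / 2 \<le> c * (L * N ^ (p - 1) / fact p)"
      using lam guess_lt by linarith
    then have uN: "u \<le> N ^ (p - 1)" using c L by (simp add: u_def field_simps)
    have Npos: "N > 0"
    proof (rule ccontr)
      assume "\<not> N > 0"
      then have "N = 0" using N by simp
      then show False using uN u p1 p by (simp add: power_0_left split: if_splits)
    qed
    \<comment> \<open>The power \<open>2 / m\<close> produces the \<open>N\<^sup>2\<close> of the
      gain.\<close>
    have "u powr (2 / m) \<le> (N ^ (p - 1)) powr (2 / m)"
      using uN u m by (intro powr_mono2) auto
    also have "N ^ (p - 1) = N powr m" using powr_realpow[OF Npos, of "p - 1"] unfolding m(2) by (rule sym)
    also have "(N powr m) powr (2 / m) = N\<^sup>2" using Npos m by (simp add: powr_powr)
    finally have "l * a * u powr (2 / m) \<le> l * gA r (t + 1) * N\<^sup>2"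
      using l a ss by (intro mult_mono) auto
    also have "\<dots> = gain t"
    proof -
      have "1 * l \<le> K * l" using K l by (intro mult_right_mono) auto
      then show ?thesis using False by (simp add: gain_def N_def l_def)
    qed
    finally have "1 \<le> gain t / (l * a * u powr (2 / m))"
      using l a u by simp
    then have "1 \<le> gain t * weight l a"
      using p1 by (simp add: weight_def u_def K_def m_def)
    moreover have "0 \<le> 2 * K * sqrt l * (sqrt (A (t + 1)) - sqrt (A t))"
      using K l ss(9) by (intro mult_nonneg_nonneg) auto
    ultimately show ?thesis by (simp add: K_def l_def)
  qed
qed

section \<open>Epochs: steps that share one guess\<close>

abbreviation "C\<^sub>i \<equiv> const_init p c"
abbreviation "C\<^sub>e \<equiv> const_epoch p c c1 c2"
abbreviation "C\<^sub>s \<equiv> const_start p c c1 c2"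

text \<open>
  \<open>C\<^sub>i \<Phi> (A 1)\<close> is at least \<open>1\<close>, an epoch stored at \<open>s\<close> has at most \<open>(C\<^sub>e + C\<^sub>i) \<Phi> (A s)\<close> steps, and
  \<open>C\<^sub>s\<close> is chosen such that \<open>C\<^sub>s + C\<^sub>e + C\<^sub>i\<close> is at most \<open>C\<^sub>s\<close> times the growth factor of \<open>\<Phi>\<close> when
  \<open>A\<close> doubles.
\<close>

definition budget :: "nat \<Rightarrow> bool" where
  "budget t \<longleftrightarrow> energy t + 3 / 8 * (\<Sum>j<t. gain j) \<le> D0 \<and> (\<forall>j<t. 0 \<le> gain j)"

text \<open>Induction invariant: the guess \<open>l\<close> was fixed at \<open>s\<close>, and the
  bound on \<open>real s\<close> accounts for all steps before. \<open>A 1 \<le> A s\<close>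
  transfers positivity and the charge for a single step from \<open>A 1\<close> to
  \<open>A s\<close>.\<close>

definition epoch :: "nat \<Rightarrow> real \<Rightarrow> nat \<Rightarrow> bool" where
  "epoch s l t \<longleftrightarrow> 1 \<le> s \<and> s \<le> t \<and> stored r t = s \<and> A 1 \<le> A s
     \<and> real s \<le> C\<^sub>s * \<Phi> (A s)
     \<and> c1 * guess_size p \<delta> L D0 (A s) \<le> l \<and> l \<le> c2 * guess_size p \<delta> L D0 (A s)
     \<and> (\<forall>j\<in>{s..t}. gl r j = l \<and> A s \<le> A j \<and> A j \<le> 2 * A s)"

lemma const_nonneg: "C\<^sub>i \<ge> 0" "C\<^sub>e \<ge> 0" "C\<^sub>s \<ge> C\<^sub>i"
  and const_start_ge: "C\<^sub>s + (C\<^sub>e + C\<^sub>i)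
      \<le> C\<^sub>s * 2 powr (2 / (3 * real p + 1))"
proof -
  define \<theta> where "\<theta> = (2::real) powr (2 / (3 * real p + 1))"
  have "\<theta> > 2 powr 0" unfolding \<theta>_def by (rule powr_less_mono) auto
  then have \<theta>: "\<theta> > 1" by simp
  show i: "C\<^sub>i \<ge> 0" using c by (simp add: const_init_def)
  show e: "C\<^sub>e \<ge> 0" using c c1 c2 slack by (simp add: const_epoch_def)
  have "0 \<le> (C\<^sub>e + C\<^sub>i) / (\<theta> - 1)" using i e \<theta> by simp
  then show "C\<^sub>s \<ge> C\<^sub>i"
    unfolding const_start_def \<theta>_def[symmetric] by linarith
  have "(C\<^sub>e + C\<^sub>i) = (C\<^sub>e + C\<^sub>i) / (\<theta> - 1) * (\<theta> - 1)"
    using \<theta> by simp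
  also have "\<dots> \<le> C\<^sub>s * (\<theta> - 1)"
    using \<theta> i by (intro mult_right_mono) (simp_all add: const_start_def flip: \<theta>_def)
  finally show "C\<^sub>s + (C\<^sub>e + C\<^sub>i)
      \<le> C\<^sub>s * 2 powr (2 / (3 * real p + 1))"
    by (simp add: \<theta>_def algebra_simps)
qed

lemma energy_nonneg:
  assumes "t \<le> T" "A t \<ge> 0"
  shows "energy t \<ge> 0"
  using xstar_le[of "xx r t"] iterates_in_Rd[OF assms(1)] assms by (simp add: energy_def)

lemma budget_Suc:
  assumes "budget t" "t < T" "gl r t > 0" "A t \<ge> 0"
  shows "budget (t + 1)"
proof -
  have "energy (t + 1) + 3 / 8 * ((\<Sum>j<t. gain j) + gain t) \<le> D0"
    using assms(1) energy_descent[OF assms(2-4)] unfolding budget_def distrib_left by linarith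
  then show ?thesis
    using assms(1) gain_nonneg[OF assms(2-4)] by (simp add: budget_def less_Suc_eq)
qed

lemma budget_sum:
  assumes "budget t" "t \<le> T" "A t \<ge> 0"
  shows "(\<Sum>j<t. gain j) \<le> 8 / 3 * D0"
  using assms energy_nonneg[OF assms(2,3)] by (simp add: budget_def)

text \<open>With \<open>A 0 = 0\<close> and \<open>lam r 0\<close> itself as guess, the root is
  \<open>1 / lam r 0\<close> and \<open>beta r 0\<close> is \<open>1\<close>.\<close>

lemma first_step: "gl r 0 > 0" "A 1 > 0" "budget 1" "lam r 0 * A 1 = 1" "gain 0 = (mov 0)\<^sup>2"
proof -
  have T0: "0 < T" using T by simp
  have lam: "lam r 0 > 0" using lam0 initial(5) by (metis snd_conv)
  have gl: "gl r 0 = lam r 0" using guess[OF T0] by (simp add: aine_guess_def)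
  then show "gl r 0 > 0" using lam by simp
  note st = step[OF T0, unfolded aine_step_def]
  have "ga r 1 = 1 / lam r 0" "beta r 0 = 1" using st lam gl initial by auto
  then have A1: "gA r 1 = 1 / lam r 0" "A 1 = 1 / lam r 0" using st initial by auto
  then show "A 1 > 0" "lam r 0 * A 1 = 1" using lam by auto
  show "gain 0 = (mov 0)\<^sup>2" using A1 lam by (simp add: gain_def gl)
  have "energy 0 = D0" by (simp add: energy_def initial D0)
  then have "budget 0" by (simp add: budget_def)
  then show "budget 1" using budget_Suc[of 0] T0 lam gl initial by simp
qed

text \<open>The energy limits the first movement, hence \<open>lam r 0\<close>, so
  \<open>lam r 0 * A 1 = 1\<close> keeps \<open>A 1\<close> from being small. This lets a single
  step be charged to \<open>\<Phi>\<close>.\<close>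

lemma initial_progress: "1 \<le> C\<^sub>i * \<Phi> (A 1)"
proof -
  define M where "M = sqrt (8 / 3) ^ (p - 1) / fact p"
  define Y where "Y = sqrt D0 ^ (p - 1) * L * A 1"
  have M: "M > 0" by (simp add: M_def)
  have Y: "Y \<ge> 0" using D0_nonneg L first_step by (simp add: Y_def)
  have "(mov 0)\<^sup>2 \<le> 8 / 3 * D0"
    using budget_sum[of 1] first_step T by simp
  then have "mov 0 \<le> sqrt (8 / 3 * D0)" by (rule real_le_rsqrt)
  then have "mov 0 ^ (p - 1) \<le> sqrt (8 / 3 * D0) ^ (p - 1)"
    by (intro power_mono mov_nonneg)
  also have "\<dots> = sqrt (8 / 3) ^ (p - 1) * sqrt D0 ^ (p - 1)"
    by (simp only: real_sqrt_mult power_mult_distrib)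
  finally have "L * mov 0 ^ (p - 1) / fact p \<le> L * (sqrt (8 / 3) ^ (p - 1) * sqrt D0 ^ (p - 1)) / fact p"
    using L by (intro divide_right_mono mult_left_mono) auto
  also have "\<dots> = M * (sqrt D0 ^ (p - 1) * L)" by (simp add: M_def)
  finally have "c * (\<delta> + L * mov 0 ^ (p - 1) / fact p) \<le> c * (\<delta> + M * (sqrt D0 ^ (p - 1) * L))"
    using c by simp
  then have "lam r 0 \<le> c * (\<delta> + M * (sqrt D0 ^ (p - 1) * L))"
    using oracle_output(4)[of 0] T by simp
  then have "lam r 0 * A 1 \<le> c * (\<delta> + M * (sqrt D0 ^ (p - 1) * L)) * A 1"
    using first_step by (intro mult_right_mono) auto
  then have "1 \<le> c * (\<delta> * A 1) + c * M * Y"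
    using first_step(4) by (simp add: Y_def algebra_simps)
  then consider "1 / 2 \<le> c * (\<delta> * A 1)" | "1 / 2 \<le> c * M * Y" by linarith
  then show ?thesis
  proof cases
    case 1
    then have "1 \<le> sqrt (2 * c * (\<delta> * A 1))" by simp
    also have "\<dots> = sqrt (2 * c) * sqrt (\<delta> * A 1)" by (simp add: real_sqrt_mult)
    also have "\<dots> \<le> C\<^sub>i * \<Phi> (A 1)"
      using c \<delta> first_step by (intro mult_mono) (auto simp: const_init_def \<Phi>_def)
    finally show ?thesis .
  next
    case 2
    then have "1 \<le> (2 * c * M * Y) powr (2 / (3 * real p + 1))"
      by (intro ge_one_powr_ge_zero) auto
    also have "\<dots> = (2 * c * M) powr (2 / (3 * real p + 1)) * Y powr (2 / (3 * real p + 1))"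
      using c M Y by (simp add: powr_mult)
    also have "\<dots> \<le> C\<^sub>i * \<Phi> (A 1)"
      using c \<delta> first_step by (intro mult_mono) (auto simp: const_init_def \<Phi>_def M_def Y_def)
    finally show ?thesis .
  qed
qed

text \<open>If \<open>\<delta>\<close> and the \<open>D0\<close> term both vanished,
  \<open>\<Phi> (A 1)\<close> would be zero, against \<open>initial_progress\<close>.\<close>

lemma guess_size_pos:
  assumes "A 1 \<le> a"
  shows "guess_size p \<delta> L D0 a > 0"
proof -
  have a: "a > 0" using first_step assms by simp
  have "\<delta> > 0 \<or> sqrt D0 ^ (p - 1) * L > 0"
  proof (rule ccontr)
    assume "\<not> ?thesis"
    moreover have "sqrt D0 ^ (p - 1) * L \<ge> 0" using L D0_nonneg by simp
    ultimately have z: "\<delta> = 0" "sqrt D0 ^ (p - 1) * L = 0" using \<delta> by linarith+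
    have "\<Phi> (A 1) = 0" unfolding \<Phi>_def by (simp only: z) simp
    then show False using initial_progress by simp
  qed
  then have "0 < \<delta> + (sqrt D0 ^ (p - 1) * L * a) powr (4 / (3 * real p + 1)) / a"
  proof
    assume "0 < sqrt D0 ^ (p - 1) * L"
    then have "0 < sqrt D0 ^ (p - 1) * L * a" using a by (rule mult_pos_pos)
    then have "0 < (sqrt D0 ^ (p - 1) * L * a) powr (4 / (3 * real p + 1)) / a"
      by (intro divide_pos_pos a powr_gt_zero[THEN iffD2]) (metis less_irrefl)
    then show ?thesis using \<delta> by linarith
  qed (use a in \<open>simp add: add_pos_nonneg\<close>)
  then show ?thesis using guess_size_eq[OF p L D0_nonneg a] by simp
qed

lemma epochD:
  assumes "epoch s l t"
  shows "1 \<le> s" "s \<le> t" "stored r t = s" "A s > 0" "A 1 \<le> A s" "l > 0"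
    and "real s \<le> C\<^sub>s * \<Phi> (A s)"
    and "c1 * guess_size p \<delta> L D0 (A s) \<le> l" "l \<le> c2 * guess_size p \<delta> L D0 (A s)"
    and "\<And>j. s \<le> j \<Longrightarrow> j \<le> t \<Longrightarrow> gl r j = l \<and> A s \<le> A j \<and> A j \<le> 2 * A s"
proof -
  note e = assms[unfolded epoch_def]
  show "A s > 0" using e first_step by auto
  have "0 < c1 * guess_size p \<delta> L D0 (A s)" using guess_size_pos[of "A s"] e c1 by simp
  then show "l > 0" using e by linarith
qed (use assms in \<open>auto simp: epoch_def\<close>)

text \<open>Summing \<open>step_progress\<close> over the epoch telescopes in \<open>sqrt A\<close>
  and collects the gains, which the energy bounds.\<close>

lemma epoch_length:
  assumes ep: "epoch s l t" and t: "t < T" and bud: "budget t"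
  shows "real t + 1 \<le> real s + (C\<^sub>e + C\<^sub>i) * \<Phi> (A s)"
proof -
  define K where "K = slack c c1"
  define w where "w = weight (l) (A s)"
  note e = epochD[OF ep]
  have K: "K \<ge> 1" using slack by (simp add: K_def)
  have w: "w \<ge> 0" using e by (simp add: w_def weight_def)
  have At: "A s \<le> A t" "A t \<le> 2 * A s" using e(10)[of t] e(2) by auto
  have "real t - real s = (\<Sum>j\<in>{s..<t}. 1)" using e(2) by simp
  also have "\<dots> \<le> (\<Sum>j\<in>{s..<t}. 2 * K * sqrt l * (sqrt (A (Suc j)) - sqrt (A j)) + gain j * w)"
  proof (rule sum_mono)
    fix j assume j: "j \<in> {s..<t}"
    then have "gl r j = l" "A s \<le> A j" using e(10)[of j] by auto
    then show "1 \<le> 2 * K * sqrt l * (sqrt (A (Suc j)) - sqrt (A j)) + gain j * w"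
      using step_progress[of j "A s"] j t e(4,6,8) by (simp add: K_def w_def)
  qed
  also have "\<dots> = 2 * K * sqrt l * (sqrt (A t) - sqrt (A s)) + (\<Sum>j\<in>{s..<t}. gain j) * w"
    using sum_Suc_diff'[OF e(2), of "\<lambda>j. sqrt (A j)"]
    by (simp add: sum.distrib sum_distrib_right flip: sum_distrib_left)
  also have "\<dots> \<le> 2 * K * sqrt l * sqrt (A s) + 8 / 3 * D0 * w"
  proof (intro add_mono mult_left_mono mult_right_mono w)
    have "sqrt (A t) \<le> sqrt (2\<^sup>2 * A s)" using At e(4) by (intro real_sqrt_le_mono) auto
    also have "\<dots> = 2 * sqrt (A s)" by (simp only: real_sqrt_mult real_sqrt_abs)
    finally show "sqrt (A t) - sqrt (A s) \<le> sqrt (A s)" by simp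
    have "(\<Sum>j\<in>{s..<t}. gain j) \<le> (\<Sum>j<t. gain j)"
      using bud by (intro sum_mono2) (auto simp: budget_def)
    also have "\<dots> \<le> 8 / 3 * D0" using budget_sum[OF bud] t At e(4) by simp
    finally show "(\<Sum>j\<in>{s..<t}. gain j) \<le> 8 / 3 * D0" .
    show "0 \<le> 2 * K * sqrt l" using K e(6) by simp
  qed
  also have "\<dots> = 2 * K * (sqrt l * sqrt (A s)) + 8 / 3 * (D0 * w)" by simp
  also have "\<dots> \<le> 2 * K * (sqrt c2 * \<Phi> (A s)) + 8 / 3 *
      (1 / (c1 * (slack c c1 * fact p / (2 * c) * c1) powr (2 / (real p - 1))) * \<Phi> (A s))"
    using K e guess_size_\<Phi>[of "A s" "l"] weight_\<Phi>[of "A s" "l"] unfolding w_def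
    by (intro add_mono mult_left_mono) auto
  also have "\<dots> = C\<^sub>e * \<Phi> (A s)" by (simp add: const_epoch_def K_def distrib_right)
  finally have "real t - real s \<le> C\<^sub>e * \<Phi> (A s)" .
  \<comment> \<open>Step \<open>t\<close> itself may leave the range up to \<open>2 * A s\<close>;
    it is not in the sum and is charged to \<open>C\<^sub>i\<close>.\<close>
  moreover have "C\<^sub>i * \<Phi> (A 1) \<le> C\<^sub>i * \<Phi> (A s)"
    using const_nonneg e first_step by (intro mult_left_mono \<Phi>_mono) auto
  ultimately show ?thesis using initial_progress by (simp add: distrib_right)
qed

text \<open>A new epoch opens only after \<open>A\<close> has more than doubled; then
  \<open>\<Phi>\<close> has grown enough for \<open>C\<^sub>s * \<Phi>\<close> to cover the old
  start plus the finished epoch.\<close>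

lemma epoch_Suc:
  assumes ep: "epoch s l t" and bud: "budget t" and t: "t + 1 < T"
  shows "\<exists>s l. epoch s l (t + 1)"
proof -
  note e = epochD[OF ep]
  have "gl r t > 0" "A t \<ge> 0" "A s \<le> A t" using e(10)[of t] e(2,4,6) by auto
  then have A: "A s \<le> A (t + 1)" using step_size(9)[of t] t by simp
  show ?thesis
  proof (cases "A (t + 1) > 2 * A s")
    case True
    have "real (t + 1) \<le> real s + (C\<^sub>e + C\<^sub>i) * \<Phi> (A s)"
      using epoch_length[OF ep _ bud] t by simp
    also have "\<dots> \<le> (C\<^sub>s + (C\<^sub>e + C\<^sub>i)) * \<Phi> (A s)"
      using e(7) by (simp add: distrib_right)
    also have "\<dots> \<le> C\<^sub>s * 2 powr (2 / (3 * real p + 1)) * \<Phi> (A s)"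
      using const_start_ge e(4) by (intro mult_right_mono \<Phi>_nonneg) auto
    also have "\<dots> \<le> C\<^sub>s * \<Phi> (A (t + 1))"
      using True e(4) const_nonneg \<Phi>_double[of "A s" "A (t + 1)"]
      by (simp add: mult.assoc mult_left_mono)
    finally have "real (t + 1) \<le> C\<^sub>s * \<Phi> (A (t + 1))" .
    then show ?thesis
      using guess[OF t] True e A by (auto simp: aine_guess_def epoch_def)
  next
    case False
    then have "epoch s l (t + 1)"
      using guess[OF t] ep e A by (auto simp: aine_guess_def epoch_def le_Suc_eq)
    then show ?thesis by blast
  qed
qed

lemma epoch_exists: "1 \<le> t \<Longrightarrow> t < T \<Longrightarrow> budget t \<and> (\<exists>s l. epoch s l t)"
proof (induction t rule: nat_induct_at_least)
  case base
  have "C\<^sub>i * \<Phi> (A 1) \<le> C\<^sub>s * \<Phi> (A 1)"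
    using const_nonneg first_step by (intro mult_right_mono \<Phi>_nonneg) auto
  then have "epoch 1 (gl r 1) 1"
    using guess[OF base] initial_progress first_step
    by (auto simp: aine_guess_def epoch_def)
  then show ?case using first_step by blast
next
  case (Suc t)
  then obtain s l where ep: "epoch s l t" and bud: "budget t" by auto
  have "gl r t > 0" "A t \<ge> 0"
    using epochD(4,6)[OF ep] epochD(10)[OF ep epochD(2)[OF ep] order_refl] by auto
  then show ?case
    using budget_Suc[OF bud] epoch_Suc[OF ep bud] Suc.prems by simp
qed

section \<open>From step counts to rates\<close>

lemma final_progress: "budget T" "A T > 0" "real T \<le> (C\<^sub>s + (C\<^sub>e + C\<^sub>i)) * \<Phi> (A T)"
proof -
  define C where "C = C\<^sub>s + (C\<^sub>e + C\<^sub>i)"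
  have C: "C \<ge> C\<^sub>i" "C \<ge> 0" using const_nonneg by (auto simp: C_def)
  have "budget T \<and> A T > 0 \<and> real T \<le> C * \<Phi> (A T)"
  proof (cases "T = 1")
    case True
    have "C\<^sub>i * \<Phi> (A 1) \<le> C * \<Phi> (A 1)"
      using C first_step by (intro mult_right_mono \<Phi>_nonneg) auto
    then show ?thesis using True first_step initial_progress by simp
  next
    case False
    \<comment> \<open>Guesses exist only below \<open>T\<close>, so the epoch of iteration
      \<open>T - 1\<close> is used; its length bound already counts that iteration.\<close>
    then obtain t where t: "T = t + 1" "1 \<le> t" using T by (cases T) auto
    then obtain s l where ep: "epoch s l t" and bud: "budget t" using epoch_exists[of t] by auto
    note e = epochD[OF ep]
    have gl: "gl r t > 0" "A t \<ge> 0" "A s \<le> A t" using e(10)[of t] e(2,4,6) by auto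
    then have A: "A s \<le> A T" using step_size(9)[of t] t by simp
    have "real T \<le> C * \<Phi> (A s)"
      using epoch_length[OF ep _ bud] t e(7) by (simp add: C_def distrib_right)
    also have "\<dots> \<le> C * \<Phi> (A T)" using C A e(4) by (intro mult_left_mono \<Phi>_mono) auto
    finally show ?thesis using budget_Suc[OF bud] t gl e(4) A by simp
  qed
  then show "budget T" "A T > 0" "real T \<le> (C\<^sub>s + (C\<^sub>e + C\<^sub>i)) * \<Phi> (A T)"
    by (auto simp: C_def)
qed

lemma value_bound: "f (xx r T) - f xstar \<le> D0 / A T"
proof -
  have "(\<Sum>j<T. gain j) \<ge> 0" using final_progress(1) by (auto simp: budget_def intro: sum_nonneg)
  then have "energy T \<le> D0" using final_progress(1) by (simp add: budget_def)
  moreover have "A T * (f (xx r T) - f xstar) \<le> energy T" by (simp add: energy_def)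
  ultimately have "A T * (f (xx r T) - f xstar) \<le> D0" by linarith
  then show ?thesis using final_progress(2) by (simp add: field_simps)
qed

text \<open>One of the two terms of \<open>\<Phi>\<close> reaches \<open>T / (2 * C)\<close>.
  Inverting its power bounds \<open>A T\<close> by the matching term of the rate, which is at least
  the minimum in \<open>lower_rate\<close>; in \<open>upper_rate\<close> it is a summand.\<close>

lemma rates:
  fixes C \<kappa> :: real
  assumes C: "C > 0" "real T \<le> C * \<Phi> (A T)"
    and \<kappa>: "\<kappa> > 0" "\<kappa> \<le> (1 / (2 * C))\<^sup>2" "\<kappa> \<le> (1 / (2 * C)) powr ((3 * real p + 1) / 2)"
  shows "ereal \<kappa> * lower_rate p \<delta> L D0 T \<le> ereal (A T)"
    and "D0 / A T \<le> 1 / \<kappa> * upper_rate p \<delta> L D0 T"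
proof -
  define h where "h = (3 * real p + 1) / 2"
  define X where "X = sqrt D0 ^ (p - 1) * L"
  have A: "A T > 0" by (rule final_progress)
  have Tpos: "real T > 0" using T by simp
  have h: "h > 0" "2 / (3 * real p + 1) = 1 / h" by (simp_all add: h_def)
  have X: "X \<ge> 0" using L D0_nonneg by (simp add: X_def)
  have D0X: "D0 * X = L * D0 powr ((real p + 1) / 2)"
  proof (cases "D0 = 0")
    case False
    then have D: "D0 > 0" using D0_nonneg by simp
    have "D0 * sqrt D0 ^ (p - 1) = D0 powr 1 * D0 powr (real (p - 1) / 2)"
      using D by (simp add: powr_powr flip: powr_half_sqrt powr_realpow)
    also have "\<dots> = D0 powr (1 + real (p - 1) / 2)" by (simp only: powr_add)
    also have "1 + real (p - 1) / 2 = (real p + 1) / 2" using p by (simp add: field_simps)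
    finally show ?thesis by (simp add: X_def)
  qed simp
  have "real T \<le> C * (sqrt (\<delta> * A T) + (X * A T) powr (1 / h))"
    using C(2) by (simp only: \<Phi>_def X_def h(2))
  then have "real T / (2 * C) \<le> (sqrt (\<delta> * A T) + (X * A T) powr (1 / h)) / 2"
    using C(1) by (simp add: divide_simps mult_ac)
  then consider "real T / (2 * C) \<le> sqrt (\<delta> * A T)" | "real T / (2 * C) \<le> (X * A T) powr (1 / h)"
    by fastforce
  then have "ereal \<kappa> * lower_rate p \<delta> L D0 T \<le> ereal (A T) \<and> D0 / A T \<le> 1 / \<kappa> * upper_rate p \<delta> L D0 T"
  proof cases
    case 1
    then have "(real T / (2 * C))\<^sup>2 \<le> (sqrt (\<delta> * A T))\<^sup>2" using C by (intro power_mono) auto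
    then have "(1 / (2 * C))\<^sup>2 * (real T)\<^sup>2 \<le> \<delta> * A T"
      using \<delta> A by (simp add: power_divide)
    then have le: "\<kappa> * (real T)\<^sup>2 \<le> \<delta> * A T"
      using mult_right_mono[OF \<kappa>(2), of "(real T)\<^sup>2"] by simp
    have "0 < \<kappa> * (real T)\<^sup>2" using \<kappa> Tpos by simp
    \<comment> \<open>The case itself excludes a zero denominator, so the extended quotient is a
      real number.\<close>
    then have \<delta>pos: "\<delta> > 0" using le \<delta> by (cases "\<delta> = 0") auto
    have "ereal \<kappa> * lower_rate p \<delta> L D0 T \<le> ereal \<kappa> * (ereal ((real T)\<^sup>2) / ereal \<delta>)"
      using \<kappa> unfolding lower_rate_def by (intro ereal_mult_left_mono min.cobounded1) auto
    also have "\<dots> = ereal (\<kappa> * (real T)\<^sup>2 / \<delta>)" using \<delta>pos by simp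
    also have "\<kappa> * (real T)\<^sup>2 / \<delta> \<le> A T"
      using le \<delta>pos by (simp add: divide_le_eq mult.commute)
    finally have low: "ereal \<kappa> * lower_rate p \<delta> L D0 T \<le> ereal (A T)" by simp
    have "1 / A T \<le> \<delta> / (\<kappa> * (real T)\<^sup>2)"
      using le A \<kappa> Tpos by (simp add: field_simps)
    then have "D0 * (1 / A T) \<le> D0 * (\<delta> / (\<kappa> * (real T)\<^sup>2))"
      using D0_nonneg by (rule mult_left_mono)
    also have "\<dots> = 1 / \<kappa> * (\<delta> * D0 / (real T)\<^sup>2)" by simp
    also have "\<dots> \<le> 1 / \<kappa> * upper_rate p \<delta> L D0 T"
      using \<kappa> L by (intro mult_left_mono) (auto simp: upper_rate_def)
    finally show ?thesis using low by simp
  next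
    case 2
    then have "(real T / (2 * C)) powr h \<le> ((X * A T) powr (1 / h)) powr h"
      using C h by (intro powr_mono2) auto
    also have "\<dots> = X * A T" using h X A by (simp add: powr_powr)
    finally have "(1 / (2 * C) * real T) powr h \<le> X * A T" by simp
    then have "(1 / (2 * C)) powr h * real T powr h \<le> X * A T"
      using C by (subst (asm) powr_mult) auto
    then have le: "\<kappa> * real T powr h \<le> X * A T"
      using mult_right_mono[OF \<kappa>(3), of "real T powr h"] by (simp add: h_def)
    have "0 < \<kappa> * real T powr h" using \<kappa> Tpos by simp
    then have Xpos: "X > 0" using le X by (cases "X = 0") auto
    have "ereal \<kappa> * lower_rate p \<delta> L D0 T \<le> ereal \<kappa> * (ereal (real T powr h) / ereal X)"
      using \<kappa> unfolding lower_rate_def h_def X_def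
      by (intro ereal_mult_left_mono min.cobounded2) auto
    also have "\<dots> = ereal (\<kappa> * real T powr h / X)" using Xpos by simp
    also have "\<kappa> * real T powr h / X \<le> A T"
      using le Xpos by (simp add: divide_le_eq mult.commute)
    finally have low: "ereal \<kappa> * lower_rate p \<delta> L D0 T \<le> ereal (A T)" by simp
    have "1 / A T \<le> X / (\<kappa> * real T powr h)"
      using le A \<kappa> Tpos by (simp add: field_simps)
    then have "D0 * (1 / A T) \<le> D0 * (X / (\<kappa> * real T powr h))"
      using D0_nonneg by (rule mult_left_mono)
    also have "\<dots> = 1 / \<kappa> * (D0 * X / real T powr h)" by simp
    also have "\<dots> \<le> 1 / \<kappa> * upper_rate p \<delta> L D0 T"
      unfolding D0X using \<kappa> \<delta> D0_nonneg
      by (intro mult_left_mono) (auto simp: upper_rate_def h_def)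
    finally show ?thesis using low by simp
  qed
  then show "ereal \<kappa> * lower_rate p \<delta> L D0 T \<le> ereal (A T)"
    and "D0 / A T \<le> 1 / \<kappa> * upper_rate p \<delta> L D0 T" by auto
qed

end

section \<open>Constants uniform over all runs\<close>

theorem theorem3p1:
  fixes p :: nat and c c1 c2 :: real
  assumes "p \<ge> 1" and "c > 0" and "0 < c1" and "c1 \<le> c2"
  shows "\<exists>\<kappa> K :: real. \<kappa> > 0 \<and> K > 0 \<and>
    (\<forall>(d::nat) (\<delta>::real) (L::real) (f :: rvec \<Rightarrow> real) xstar H Orc x0 (D0::real) (T::nat) r.
       d \<ge> 1 \<longrightarrow> \<delta> \<ge> 0 \<longrightarrow> L > 0 \<longrightarrow>
       convex_fun d f \<longrightarrow> is_minimizer d f xstar \<longrightarrow>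
       Ck_fun d p f \<longrightarrow> lipschitz_deriv d p L f \<longrightarrow>
       hessian_estimator d f \<delta> H \<longrightarrow>
       ms_oracle d p f \<delta> L c Orc \<longrightarrow>
       x0 \<in> Rd d \<longrightarrow> snd (Orc x0) > 0 \<longrightarrow>
       D0 = 1 / 2 * (vnorm d (\<lambda>i. x0 i - xstar i))\<^sup>2 \<longrightarrow>
       T \<ge> 1 \<longrightarrow>
       aine_run d p f \<delta> L c1 c2 D0 Orc x0 T r \<longrightarrow>
         ereal (AA r T) \<ge> ereal \<kappa> * lower_rate p \<delta> L D0 T \<and>
         f (xx r T) - f xstar \<le> D0 / AA r T \<and>
         D0 / AA r T \<le> K * upper_rate p \<delta> L D0 T)"
proof -
  \<comment> \<open>\<open>C\<close> and \<open>\<kappa>\<close> involve only \<open>p\<close>,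
    \<open>c\<close>, \<open>c1\<close> and \<open>c2\<close>; the maximum with \<open>1\<close>
    keeps \<open>C\<close> positive, and the minimum serves both cases of
    \<open>rates\<close>.\<close>
  define C where "C = max 1 (const_start p c c1 c2 + (const_epoch p c c1 c2 + const_init p c))"
  define \<kappa> where "\<kappa> = min ((1 / (2 * C))\<^sup>2) ((1 / (2 * C)) powr ((3 * real p + 1) / 2))"
  have C: "C > 0" by (simp add: C_def)
  then have \<kappa>: "\<kappa> > 0" by (simp add: \<kappa>_def)
  have concl: "ereal \<kappa> * lower_rate p \<delta> L D0 T \<le> ereal (AA r T) \<and>
      f (xx r T) - f xstar \<le> D0 / AA r T \<and> D0 / AA r T \<le> 1 / \<kappa> * upper_rate p \<delta> L D0 T"
    if "aine p d T c c1 c2 \<delta> L D0 f xstar x0 Orc r" for d T \<delta> L D0 f xstar x0 Orc r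
  proof -
    interpret aine p d T c c1 c2 \<delta> L D0 f xstar x0 Orc r by (rule that)
    have "C\<^sub>s + (C\<^sub>e + C\<^sub>i) \<le> C" by (simp add: C_def)
    then have "(C\<^sub>s + (C\<^sub>e + C\<^sub>i)) * \<Phi> (AA r T) \<le> C * \<Phi> (AA r T)"
      using final_progress(2) by (intro mult_right_mono \<Phi>_nonneg) auto
    with final_progress(3) have "real T \<le> C * \<Phi> (AA r T)" by linarith
    from rates[OF C this \<kappa>] value_bound show ?thesis by (simp add: \<kappa>_def)
  qed
  have "1 / \<kappa> > 0" using \<kappa> by simp
  show ?thesis
    by (rule exI[of _ \<kappa>], rule exI[of _ "1 / \<kappa>"],
        intro conjI[OF \<kappa>] conjI[OF \<open>1 / \<kappa> > 0\<close>] allI impI, rule concl, rule aine.intro)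
      (assumption | rule assms)+
qed

end
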